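(* Let $G$ be a connected graph with $n$ vertices and $m$ edges, let $T$ be a spanning tree of $G$, and let $\beta'$ be the matching number of $T$. (i) If $0\leq \alpha< \frac{1}{2}$, then $$S_k(A_{\alpha}(G))\leq \begin{cases} \alpha(n+2k-2)+(1-2\alpha)\sqrt{k(n-1)}+m-n+1, & \text{if } 1\leq k \leq \beta';\\ \alpha(n+2k-2)+(1-2\alpha)\sqrt{\beta' (n-1)}+m-n+1, & \text{if } \beta'< k \leq n-\beta';\\ \alpha(n+2k-2)+(1-2\alpha)\sqrt{(n-k)(n-1)}+m-n+1, & \text{if } n-\beta'< k \leq n. \end{cases}$$ (ii) If $\frac{1}{2}\leq \alpha< 1$, then $S_k(A_{\alpha}(G))\leq \alpha(2k+2m-n)$ for $2\leq k \leq n$.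
   Context: All graphs are simple and undirected. $A_{\alpha}(G)=\alpha D(G)+(1-\alpha)A(G)$, where $A(G)$ is the adjacency matrix and $D(G)$ the diagonal degree matrix. For a real symmetric matrix $M$ with eigenvalues $\lambda_1(M)\geq\cdots\geq\lambda_n(M)$, $S_k(M)=\sum_{i=1}^k\lambda_i(M)$. The matching number is the maximum size of a matching. *)

theory Defs
  imports "Jordan_Normal_Form.Char_Poly" "HOL-Computational_Algebra.Polynomial"
begin

definition simple_graph :: "nat \<Rightarrow> nat set set \<Rightarrow> bool" where
  "simple_graph n E \<longleftrightarrow> (\<forall>e\<in>E. \<exists>u v. e = {u, v} \<and> u \<noteq> v \<and> u < n \<and> v < n)"

definition adj :: "nat set set \<Rightarrow> nat \<Rightarrow> nat \<Rightarrow> bool" where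
  "adj E u v \<longleftrightarrow> {u, v} \<in> E"

definition connected_graph :: "nat \<Rightarrow> nat set set \<Rightarrow> bool" where
  "connected_graph n E \<longleftrightarrow> n \<ge> 1 \<and>
     (\<forall>u<n. \<forall>v<n. (adj E)\<^sup>*\<^sup>* u v)"

definition is_cycle :: "nat set set \<Rightarrow> nat list \<Rightarrow> bool" where
  "is_cycle E vs \<longleftrightarrow> length vs \<ge> 3 \<and> distinct vs \<and>
     (\<forall>i<length vs. {vs ! i, vs ! ((i + 1) mod length vs)} \<in> E)"

definition acyclic_graph :: "nat set set \<Rightarrow> bool" where
  "acyclic_graph E \<longleftrightarrow> \<not> (\<exists>vs. is_cycle E vs)"

definition is_tree :: "nat \<Rightarrow> nat set set \<Rightarrow> bool" where
  "is_tree n T \<longleftrightarrow> simple_graph n T \<and> connected_graph n T \<and> acyclic_graph T"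

definition spanning_tree :: "nat \<Rightarrow> nat set set \<Rightarrow> nat set set \<Rightarrow> bool" where
  "spanning_tree n E T \<longleftrightarrow> T \<subseteq> E \<and> is_tree n T"

definition is_matching :: "nat set set \<Rightarrow> nat set set \<Rightarrow> bool" where
  "is_matching E M \<longleftrightarrow> M \<subseteq> E \<and> (\<forall>e\<in>M. \<forall>f\<in>M. e \<noteq> f \<longrightarrow> e \<inter> f = {})"

definition matching_number :: "nat set set \<Rightarrow> nat" where
  "matching_number E = Max (card ` {M. is_matching E M})"

definition degree :: "nat set set \<Rightarrow> nat \<Rightarrow> nat" where
  "degree E v = card {e \<in> E. v \<in> e}"

definition adj_matrix :: "nat \<Rightarrow> nat set set \<Rightarrow> real mat" where
  "adj_matrix n E = mat n n (\<lambda>(i, j). if {i, j} \<in> E then 1 else 0)"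

definition deg_matrix :: "nat \<Rightarrow> nat set set \<Rightarrow> real mat" where
  "deg_matrix n E = mat n n (\<lambda>(i, j). if i = j then real (degree E i) else 0)"

definition A_alpha :: "real \<Rightarrow> nat \<Rightarrow> nat set set \<Rightarrow> real mat" where
  "A_alpha \<alpha> n E = \<alpha> \<cdot>\<^sub>m deg_matrix n E + (1 - \<alpha>) \<cdot>\<^sub>m adj_matrix n E"

text \<open>Eigenvalues (with multiplicity, as roots of the characteristic polynomial),
in non-increasing order; for real symmetric matrices all roots are real.\<close>

definition eigenvalues_desc :: "real mat \<Rightarrow> real list" where
  "eigenvalues_desc M = rev (sorted_list_of_multiset (proots (char_poly M)))"

definition S_k :: "nat \<Rightarrow> real mat \<Rightarrow> real" where
  "S_k k M = sum_list (take k (eigenvalues_desc M))"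

end

theory Submission
  imports Defs "Jordan_Normal_Form.Schur_Decomposition"
begin

text \<open>
  If $P$ is the orthogonal projection onto the span of the eigenvectors of the $k$ largest
  eigenvalues, then $S_k(M) = \mathrm{tr}(PM)$; so it suffices to bound $\mathrm{tr}(PM)$ for an arbitrary
  projection $P$ of rank $k$. Let $Q = D + A$. Then
  $A_\alpha = \alpha Q + (1 - 2\alpha) A = (2\alpha - 1) D + (1 - \alpha) Q$, and the first form is used for
  $\alpha < 1/2$, the second one for $\alpha \geq 1/2$.

  Without isolated vertices, $\mathrm{tr}(PD) \leq k + (2m - n)$ because the diagonal of $P$ lies in
  $[0,1]$, and $\mathrm{tr}(PQ) \leq 2k + (2m - n)$: if $Qu = \mu u$ with $u$ a unit vector, then
  $Q \leq 2D$ gives $\mu\, u^T D^{-1} u \leq 2$, that is $\mu - 2 \leq \mu\, u^T (I - D^{-1}) u$, and the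
  right-hand side summed over an eigenbasis is $\mathrm{tr}((I - D^{-1}) Q) = 2m - n$.

  Each edge outside $T$ contributes at most $1$ to $\mathrm{tr}(PA)$. For the forest $T$ with its
  $n - 1$ edges, the bound $\sqrt{k(n-1)}$ follows by Cauchy--Schwarz, since an off-diagonal block
  of $P$ has squared Frobenius norm at most $k/4$; replacing $P$ by $I - P$ gives
  $\sqrt{(n-k)(n-1)}$; and splitting $T$ into stars centred at a vertex cover of size at most
  $\beta'$ gives $\sqrt{\beta'(n-1)}$, as a star with $d$ edges contributes at most $\sqrt{d}$.
\<close>

subsection \<open>Trees, matchings and vertex covers\<close>

text \<open>\<open>simple_graph\<close> without the bound on the vertices, so that inductions on
  forests need not carry \<open>n\<close>.\<close>

definition loopless :: "nat set set \<Rightarrow> bool" where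
  "loopless T \<longleftrightarrow> (\<forall>e\<in>T. \<exists>u v. e = {u, v} \<and> u \<noteq> v)"

definition is_path :: "nat set set \<Rightarrow> nat list \<Rightarrow> bool" where
  "is_path T vs \<longleftrightarrow> distinct vs \<and> (\<forall>i. Suc i < length vs \<longrightarrow> {vs ! i, vs ! Suc i} \<in> T)"

lemma acyclic_graph_subset: "acyclic_graph T \<Longrightarrow> T' \<subseteq> T \<Longrightarrow> acyclic_graph T'"
  unfolding acyclic_graph_def is_cycle_def by blast

lemma loopless_subset: "loopless T \<Longrightarrow> T' \<subseteq> T \<Longrightarrow> loopless T'"
  unfolding loopless_def by blast

lemma looplessE:
  assumes "loopless T" "e \<in> T"
  obtains u v where "e = {u, v}" "u \<noteq> v"
proof -
  have "\<exists>u v. e = {u, v} \<and> u \<noteq> v" using assms by (simp add: loopless_def)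
  then show ?thesis by (elim exE conjE) (rule that)
qed

text \<open>An end \<open>l\<close> of a longest path is a leaf: a second edge at \<open>l\<close>
  would either lead to a new vertex and prolong the path, or return to the path and close a
  cycle.\<close>

lemma acyclic_graph_leaf:
  assumes fin: "finite T" and ne: "T \<noteq> {}" and loopless: "loopless T" and acyclic: "acyclic_graph T"
  obtains l p where "{l, p} \<in> T" "l \<noteq> p" "\<And>e. e \<in> T \<Longrightarrow> l \<in> e \<Longrightarrow> e = {l, p}"
proof -
  obtain e where "e \<in> T" using ne by blast
  then obtain u v where "e = {u, v}" and "u \<noteq> v" using looplessE[OF loopless] by metis
  with \<open>e \<in> T\<close> have uv: "{u, v} \<in> T" "u \<noteq> v" by simp_all
  \<comment> \<open>Length at least 2 provides the neighbour \<open>p\<close> of the end vertex. A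
    longest such path exists because \<open>[u, v]\<close> is one and \<open>bound\<close> limits
    the length.\<close>
  define Q where "Q vs \<longleftrightarrow> is_path T vs \<and> 2 \<le> length vs" for vs
  have "Q [u, v]" using uv by (simp add: Q_def is_path_def)
  have "finite e" if e: "e \<in> T" for e
  proof -
    obtain a b where "e = {a, b}" by (rule looplessE[OF loopless e])
    then show ?thesis by simp
  qed
  then have finU: "finite (\<Union>T)" by (intro finite_Union fin)
  have bound: "length vs \<le> card (\<Union>T)" if "Q vs" for vs
  proof -
    have "vs ! i \<in> \<Union>T" if i: "i < length vs" for i
    proof (cases "Suc i < length vs")
      case True
      then have "{vs ! i, vs ! Suc i} \<in> T" using \<open>Q vs\<close> by (simp add: Q_def is_path_def)
      then show ?thesis by blast
    next
      case False
      then obtain h where h: "i = Suc h" using \<open>Q vs\<close> by (cases i) (simp_all add: Q_def)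
      then have "{vs ! h, vs ! Suc h} \<in> T" using \<open>Q vs\<close> i by (simp add: Q_def is_path_def)
      then show ?thesis using h by blast
    qed
    then have "set vs \<subseteq> \<Union>T" by (auto simp: set_conv_nth)
    then have "card (set vs) \<le> card (\<Union>T)" using finU by (rule card_mono[rotated])
    then show ?thesis using that by (simp add: Q_def is_path_def distinct_card)
  qed
  obtain vs where Qvs: "Q vs" and max: "\<And>ws. Q ws \<Longrightarrow> length ws \<le> length vs"
  proof -
    have "\<exists>vs. Q vs \<and> (\<forall>ws. Q ws \<longrightarrow> length ws \<le> length vs)"
      by (rule ex_has_greatest_nat[of Q "[u, v]" length "Suc (card (\<Union>T))"]) (simp_all add: less_Suc_eq_le \<open>Q [u, v]\<close> bound)
    then show ?thesis using that by blast
  qed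
  then have path: "is_path T vs" and "2 \<le> length vs" by (auto simp: Q_def)
  then obtain l p ps where vs: "vs = l # p # ps"
    by (auto simp: numeral_2_eq_2 Suc_le_length_iff)
  have step: "Suc i < length vs \<Longrightarrow> {vs ! i, vs ! Suc i} \<in> T" for i
    using path by (simp add: is_path_def)
  have lp: "{l, p} \<in> T" using step[of 0] by (simp add: vs)
  moreover have "l \<noteq> p" using path by (simp add: is_path_def vs)
  moreover have "e = {l, p}" if e: "e \<in> T" "l \<in> e" for e
  proof (rule ccontr)
    assume neq: "e \<noteq> {l, p}"
    obtain a b where "e = {a, b}" "a \<noteq> b" by (rule looplessE[OF loopless e(1)])
    define x where "x = (if l = a then b else a)"
    have x: "e = {l, x}" "x \<noteq> l"
      using \<open>e = {a, b}\<close> \<open>a \<noteq> b\<close> e(2) by (auto simp: x_def)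
    have "x \<noteq> p" using neq x(1) by blast
    show False
    proof (cases "x \<in> set vs")
      case False
      have "is_path T (x # vs)"
        unfolding is_path_def
      proof (intro conjI allI impI)
        show "distinct (x # vs)" using False path by (simp add: is_path_def)
        fix i assume "Suc i < length (x # vs)"
        then show "{(x # vs) ! i, (x # vs) ! Suc i} \<in> T"
          using step e(1) x(1) by (cases i) (simp_all add: vs insert_commute)
      qed
      then have "Q (x # vs)" using \<open>2 \<le> length vs\<close> by (simp add: Q_def)
      from max[OF this] show False by simp
    next
      case True
      then obtain i where i: "i < length vs" "vs ! i = x" by (auto simp: in_set_conv_nth)
      \<comment> \<open>\<open>x\<close> differs from \<open>l\<close> and \<open>p\<close>, the
        first two vertices, so the initial segment up to \<open>x\<close> has at least three
        vertices and the edge \<open>{l, x}\<close> closes it to a cycle.\<close>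
      have i2: "2 \<le> i" proof (rule ccontr)
        assume "\<not> 2 \<le> i"
        then have "i = 0 \<or> i = 1" by auto
        then show False using i(2) x(2) \<open>x \<noteq> p\<close> by (auto simp: vs)
      qed
      have "is_cycle T (take (Suc i) vs)"
        unfolding is_cycle_def
      proof (intro conjI allI impI)
        show "3 \<le> length (take (Suc i) vs)" using i i2 by simp
        show "distinct (take (Suc i) vs)" using path by (simp add: is_path_def)
        fix j assume "j < length (take (Suc i) vs)"
        then have j: "j \<le> i" using i by simp
        have len: "length (take (Suc i) vs) = Suc i" using i by simp
        show "{take (Suc i) vs ! j, take (Suc i) vs ! ((j + 1) mod length (take (Suc i) vs))} \<in> T"
        proof (cases "j = i")
          case True
          have "take (Suc i) vs ! i = x" "take (Suc i) vs ! 0 = l" using i by (simp, simp add: vs)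
          then show ?thesis using True e(1) x(1) unfolding len by (simp add: insert_commute)
        next
          case False
          then show ?thesis using j i step unfolding len by simp
        qed
      qed
      then show False using acyclic unfolding acyclic_graph_def by blast
    qed
  qed
  ultimately show ?thesis using that by blast
qed

text \<open>The hypothesis covers all proper subsets, not just the removal of the leaf edge, because
  the construction of the vertex cover deletes all edges at \<open>p\<close> at once.\<close>

lemma forest_induct [consumes 3, case_names empty leaf]:
  assumes "finite T" "loopless T" "acyclic_graph T"
    and empty: "P {}"
    and leaf: "\<And>T l p. finite T \<Longrightarrow> loopless T \<Longrightarrow> {l, p} \<in> T \<Longrightarrow> l \<noteq> p \<Longrightarrow>
      (\<And>e. e \<in> T \<Longrightarrow> l \<in> e \<Longrightarrow> e = {l, p}) \<Longrightarrow> (\<And>T'. T' \<subset> T \<Longrightarrow> P T') \<Longrightarrow> P T"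
  shows "P T"
  using assms(1-3)
proof (induction T rule: finite_psubset_induct)
  case (psubset T)
  show ?case
  proof (cases "T = {}")
    case False
    obtain l p where "{l, p} \<in> T" "l \<noteq> p" "\<And>e. e \<in> T \<Longrightarrow> l \<in> e \<Longrightarrow> e = {l, p}"
      using acyclic_graph_leaf[OF psubset.hyps False psubset.prems] by metis
    then show ?thesis
      using leaf psubset acyclic_graph_subset loopless_subset by (metis psubset_imp_subset)
  qed (simp add: empty)
qed

text \<open>The leaf takes the colour opposite to that of its neighbour. The adjacency matrix then
  vanishes inside both colour classes, as \<open>orth_proj_bipartite_le\<close> requires.\<close>

lemma forest_two_coloring:
  assumes "finite T" "loopless T" "acyclic_graph T"
  obtains f :: "nat \<Rightarrow> bool" where "\<And>u v. {u, v} \<in> T \<Longrightarrow> f u \<noteq> f v"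
proof -
  from assms have "\<exists>f :: nat \<Rightarrow> bool. \<forall>u v. {u, v} \<in> T \<longrightarrow> f u \<noteq> f v"
  proof (induction T rule: forest_induct)
    case (leaf T l p)
    have "T - {{l, p}} \<subset> T" using leaf.hyps(3) by blast
    from leaf.IH[OF this] obtain f :: "nat \<Rightarrow> bool"
      where f: "\<And>u v. {u, v} \<in> T - {{l, p}} \<Longrightarrow> f u \<noteq> f v" by blast
    have "(f(l := \<not> f p)) u \<noteq> (f(l := \<not> f p)) v" if uv: "{u, v} \<in> T" for u v
    proof (cases "{u, v} = {l, p}")
      case True
      then have "u = l \<and> v = p \<or> u = p \<and> v = l" by (simp add: doubleton_eq_iff)
      then show ?thesis using leaf.hyps(4) by auto
    next
      case False
      then have "l \<noteq> u" "l \<noteq> v" using leaf.hyps(5)[OF uv] by auto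
      then show ?thesis using f[of u v] uv False by simp
    qed
    then show ?case by blast
  qed auto
  then show ?thesis using that by blast
qed

text \<open>Removing a leaf together with its edge lowers both counts by one; \<open>p\<close> stays
  behind, so the vertex set never becomes empty.\<close>

lemma forest_card_edges_less:
  assumes "finite T" "loopless T" "acyclic_graph T" and V: "finite V" "V \<noteq> {}" "\<Union>T \<subseteq> V"
  shows "card T < card V"
  using assms(1-3) V
proof (induction T arbitrary: V rule: forest_induct)
  case empty
  then show ?case by (simp add: card_gt_0_iff)
next
  case (leaf T l p)
  have "T - {{l, p}} \<subset> T" using leaf.hyps(3) by blast
  moreover have "\<Union>(T - {{l, p}}) \<subseteq> V - {l}"
  proof -
    have "l \<notin> e" if "e \<in> T - {{l, p}}" for e using leaf.hyps(5)[of e] that by blast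
    then show ?thesis using leaf.prems by blast
  qed
  moreover have "p \<in> V - {l}" "l \<in> V" using leaf.hyps(3,4) leaf.prems by blast+
  ultimately have "card (T - {{l, p}}) < card (V - {l})"
    using leaf.prems(1) by (intro leaf.IH) auto
  then show ?case using leaf.hyps(1,3) leaf.prems(1) \<open>l \<in> V\<close> by (simp add: card_Diff_singleton)
qed

text \<open>Half of Koenig's theorem, for forests. The neighbour \<open>p\<close> of a leaf
  \<open>l\<close> joins the cover, the edge \<open>{l, p}\<close> joins the matching, and all edges
  at \<open>p\<close> are deleted. No remaining edge contains \<open>l\<close>, whose only edge is
  gone, so the new edge is disjoint from the rest of the matching.\<close>

lemma forest_vertex_cover:
  assumes "finite T" "loopless T" "acyclic_graph T"
  obtains M C where "is_matching T M" "finite C" "card C \<le> card M" "\<And>e. e \<in> T \<Longrightarrow> e \<inter> C \<noteq> {}"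
proof -
  from assms have "\<exists>M C. is_matching T M \<and> finite C \<and> card C \<le> card M \<and> (\<forall>e\<in>T. e \<inter> C \<noteq> {})"
  proof (induction T rule: forest_induct)
    case empty
    show ?case by (intro exI[of _ "{}"]) (auto simp: is_matching_def)
  next
    case (leaf T l p)
    let ?T = "{e \<in> T. p \<notin> e}"
    have "{l, p} \<notin> ?T" by simp
    then have "?T \<noteq> T" using leaf.hyps(3) by metis
    moreover have "?T \<subseteq> T" by (rule Collect_subset)
    ultimately have "?T \<subset> T" by (rule psubsetI[rotated])
    from leaf.IH[OF this] obtain M C where M: "is_matching ?T M" and C: "finite C" "card C \<le> card M"
      "\<forall>e\<in>?T. e \<inter> C \<noteq> {}" by (elim exE conjE) (rule that)
    have MT: "M \<subseteq> ?T" using M by (simp add: is_matching_def)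
    have disj: "e \<inter> {l, p} = {}" if "e \<in> M" for e
    proof -
      have "p \<notin> e" "e \<in> T" using MT that by auto
      moreover have "l \<notin> e"
      proof
        assume "l \<in> e"
        from leaf.hyps(5)[OF \<open>e \<in> T\<close> this] have "p \<in> e" by simp
        then show False using \<open>p \<notin> e\<close> by simp
      qed
      ultimately show ?thesis by simp
    qed
    have "is_matching T (insert {l, p} M)"
      unfolding is_matching_def
    proof (intro conjI ballI impI)
      show "insert {l, p} M \<subseteq> T" using MT leaf.hyps(3) by auto
      fix e f assume "e \<in> insert {l, p} M" "f \<in> insert {l, p} M" "e \<noteq> f"
      then consider "e = {l, p}" "f \<in> M" | "f = {l, p}" "e \<in> M" | "e \<in> M" "f \<in> M" by blast
      then show "e \<inter> f = {}"
      proof cases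
        case 3
        then show ?thesis using M \<open>e \<noteq> f\<close> unfolding is_matching_def by blast
      qed (use disj in \<open>simp_all add: Int_commute\<close>)
    qed
    moreover have "card (insert p C) \<le> card (insert {l, p} M)"
    proof -
      have "M \<subseteq> T" using MT by blast
      then have "finite M" using leaf.hyps(1) by (rule finite_subset)
      moreover have "{l, p} \<notin> M" using MT by auto
      ultimately show ?thesis using C(1,2) by (simp add: card_insert_if)
    qed
    moreover have "\<forall>e\<in>T. e \<inter> insert p C \<noteq> {}" using C(3) by blast
    moreover have "finite (insert p C)" using C(1) by simp
    ultimately show ?case by (intro exI conjI)
  qed
  then show ?thesis using that by blast
qed

lemma matching_card_le_matching_number:
  assumes "finite T" "is_matching T M"
  shows "card M \<le> matching_number T"
proof -
  have "{M. is_matching T M} \<subseteq> Pow T" by (auto simp: is_matching_def)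
  then have "finite {M. is_matching T M}" using assms(1) by (simp add: finite_subset)
  then show ?thesis unfolding matching_number_def using assms(2) by (intro Max_ge) auto
qed

lemma matching_number_le_card:
  assumes "finite T"
  shows "matching_number T \<le> card T"
proof -
  have "{M. is_matching T M} \<subseteq> Pow T" by (auto simp: is_matching_def)
  moreover have "finite (Pow T)" using assms by simp
  ultimately have "finite {M. is_matching T M}" by (rule finite_subset)
  moreover have "is_matching T {}" by (simp add: is_matching_def)
  ultimately have "matching_number T \<in> card ` {M. is_matching T M}"
    unfolding matching_number_def by (intro Max_in) auto
  then show ?thesis using assms by (auto simp: is_matching_def intro: card_mono)
qed

section \<open>Edge counts of trees and degrees in connected graphs\<close>

lemma simple_graphD:
  assumes "simple_graph n E"
  shows "finite E" "loopless E" "\<Union>E \<subseteq> {..<n}"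
proof -
  show U: "\<Union>E \<subseteq> {..<n}" using assms unfolding simple_graph_def by fastforce
  then have "E \<subseteq> Pow {..<n}" by blast
  then show "finite E" using finite_subset by blast
  show "loopless E" using assms unfolding simple_graph_def loopless_def by blast
qed

text \<open>Some step of a walk from a vertex of \<open>S\<close> to one outside must cross the
  border of \<open>S\<close>.\<close>

lemma connected_graph_leaving_edge:
  assumes conn: "connected_graph n T" and S: "S \<subset> {..<n}" "S \<noteq> {}" and T: "\<Union>T \<subseteq> {..<n}"
  obtains x y where "x \<in> S" "y \<notin> S" "y < n" "{x, y} \<in> T"
proof -
  obtain u v where uv: "u \<in> S" "v \<notin> S" "u < n" "v < n" using S by blast
  then have "(adj T)\<^sup>*\<^sup>* u v" using conn by (simp add: connected_graph_def)
  then have "v \<in> S \<or> (\<exists>x y. x \<in> S \<and> y \<notin> S \<and> y < n \<and> {x, y} \<in> T)"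
  proof (induction rule: rtranclp_induct)
    case (step y z)
    then show ?case using T unfolding adj_def by blast
  qed (use uv in auto)
  then show ?thesis using uv that by blast
qed

text \<open>A vertex set is grown from a single vertex. Each edge leaving it adds one vertex and at
  least one edge inside the set, so \<open>n - 1\<close> steps produce \<open>n - 1\<close>
  edges.\<close>

lemma connected_graph_card_edges_ge:
  assumes conn: "connected_graph n T" and fin: "finite T" and T: "\<Union>T \<subseteq> {..<n}"
  shows "n \<le> Suc (card T)"
proof -
  have "\<exists>S \<subseteq> {..<n}. card S = Suc i \<and> i \<le> card {e \<in> T. e \<subseteq> S}" if "i < n" for i
    using that
  proof (induction i)
    case 0
    then show ?case by (intro exI[of _ "{0}"]) auto
  next
    case (Suc i)
    then obtain S where S: "S \<subseteq> {..<n}" "card S = Suc i" "i \<le> card {e \<in> T. e \<subseteq> S}" by auto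
    then have "S \<subset> {..<n}" "S \<noteq> {}" using Suc.prems by auto
    then obtain x y where xy: "x \<in> S" "y \<notin> S" "y < n" "{x, y} \<in> T"
      using connected_graph_leaving_edge[OF conn _ _ T] by metis
    have finS: "finite S" using S(1) finite_subset by blast
    have "insert {x, y} {e \<in> T. e \<subseteq> S} \<subseteq> {e \<in> T. e \<subseteq> insert y S}" using xy by auto
    then have "card (insert {x, y} {e \<in> T. e \<subseteq> S}) \<le> card {e \<in> T. e \<subseteq> insert y S}"
      using fin by (intro card_mono) auto
    moreover have "card (insert {x, y} {e \<in> T. e \<subseteq> S}) = Suc (card {e \<in> T. e \<subseteq> S})"
      using fin xy by (subst card_insert_disjoint) auto
    ultimately show ?case using S xy finS by (intro exI[of _ "insert y S"]) auto
  qed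
  from this[of "n - 1"] conn obtain S where "n - 1 \<le> card {e \<in> T. e \<subseteq> S}"
    unfolding connected_graph_def by auto
  also have "\<dots> \<le> card T" using fin by (intro card_mono) auto
  finally show ?thesis by simp
qed

lemma tree_card_edges:
  assumes "is_tree n T"
  shows "Suc (card T) = n"
proof -
  have T: "finite T" "loopless T" "\<Union>T \<subseteq> {..<n}" and conn: "connected_graph n T" and ac: "acyclic_graph T"
    using assms simple_graphD by (auto simp: is_tree_def)
  have "{..<n} \<noteq> {}" using conn by (auto simp: connected_graph_def lessThan_empty_iff)
  then have "card T < card {..<n}" using T ac by (intro forest_card_edges_less)  simp_all
  then show ?thesis using connected_graph_card_edges_ge[OF conn T(1,3)] by simp
qed

text \<open>An edge leaving \<open>{i}\<close> is incident with \<open>i\<close>;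
  \<open>2 \<le> n\<close> makes \<open>{i}\<close> a proper subset. Through this bound the
  connectivity of the whole graph enters the trace estimates.\<close>

lemma connected_graph_degree_ge:
  assumes conn: "connected_graph n E" and fin: "finite E" and E: "\<Union>E \<subseteq> {..<n}"
    and i: "i < n" and n: "2 \<le> n"
  shows "1 \<le> Defs.degree E i"
proof -
  have "{i} \<subset> {..<n}"
  proof -
    have "(if i = 0 then 1 else 0) \<in> {..<n} - {i}" using n by auto
    then show ?thesis using i by blast
  qed
  from connected_graph_leaving_edge[OF conn this _ E] obtain x y where "x \<in> {i}" "{x, y} \<in> E"
    by (metis insert_not_empty)
  then have "{e \<in> E. i \<in> e} \<noteq> {}" by auto
  then show ?thesis unfolding Defs.degree_def using fin by (simp add: Suc_le_eq card_gt_0_iff)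
qed

subsection \<open>Adjacency matrices\<close>

text \<open>A plain function instead of a matrix, so that traces become double sums without
  dimension conditions.\<close>

definition adj_entry :: "nat set set \<Rightarrow> nat \<Rightarrow> nat \<Rightarrow> real" where
  "adj_entry E i j = (if {i, j} \<in> E then 1 else 0)"

lemma adj_entry_commute: "adj_entry E i j = adj_entry E j i"
  by (simp add: adj_entry_def insert_commute)

lemma adj_entry_nonneg: "0 \<le> adj_entry E i j"
  by (simp add: adj_entry_def)

lemma adj_entry_diag:
  assumes "loopless E"
  shows "adj_entry E i i = 0"
proof -
  have "{i, i} \<notin> E"
  proof
    assume "{i, i} \<in> E"
    then obtain u v where "{i, i} = {u, v}" "u \<noteq> v" by (rule looplessE[OF assms])
    then show False by (simp add: doubleton_eq_iff)
  qed
  then show ?thesis by (simp add: adj_entry_def)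
qed

lemma degree_eq_sum_adj_entry:
  assumes G: "simple_graph n E"
  shows "real (Defs.degree E i) = (\<Sum>j<n. adj_entry E i j)"
proof -
  have "bij_betw (\<lambda>j. {i, j}) {j. j < n \<and> {i, j} \<in> E} {e \<in> E. i \<in> e}"
    unfolding bij_betw_def
  proof (intro conjI subset_antisym subsetI)
    show "inj_on (\<lambda>j. {i, j}) {j. j < n \<and> {i, j} \<in> E}"
      by (rule inj_onI) (auto simp: doubleton_eq_iff)
    fix e assume e: "e \<in> {e \<in> E. i \<in> e}"
    then obtain u v where uv: "e = {u, v}" "u \<noteq> v" by (auto elim: looplessE[OF simple_graphD(2)[OF G]])
    define j where "j = (if i = u then v else u)"
    have "e = {i, j}" using uv e by (auto simp: j_def)
    moreover have "j < n" using e simple_graphD(3)[OF G] calculation by auto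
    ultimately show "e \<in> (\<lambda>j. {i, j}) ` {j. j < n \<and> {i, j} \<in> E}" using e by blast
  qed auto
  from bij_betw_same_card[OF this]
  have "Defs.degree E i = card {j. j < n \<and> {i, j} \<in> E}" by (simp add: Defs.degree_def)
  also have "real \<dots> = (\<Sum>j \<in> {j. j < n \<and> {i, j} \<in> E}. 1)" by simp
  also have "\<dots> = (\<Sum>j<n. adj_entry E i j)"
    by (intro sum.mono_neutral_cong_left) (auto simp: adj_entry_def)
  finally show ?thesis .
qed

lemma sum_adj_entry:
  assumes G: "simple_graph n E"
  shows "(\<Sum>i<n. \<Sum>j<n. adj_entry E i j) = 2 * real (card E)"
proof -
  note E = simple_graphD[OF G]
  have "(\<Sum>i<n. \<Sum>j<n. adj_entry E i j) = (\<Sum>i<n. real (Defs.degree E i))"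
    by (simp add: degree_eq_sum_adj_entry[OF G])
  also have "\<dots> = (\<Sum>i<n. \<Sum>e\<in>E. if i \<in> e then 1 else 0)"
    unfolding Defs.degree_def using E(1) by (intro sum.cong refl) (simp add: sum.If_cases Int_def)
  also have "\<dots> = (\<Sum>e\<in>E. \<Sum>i<n. if i \<in> e then 1 else 0)" by (rule sum.swap)
  also have "\<dots> = (\<Sum>e\<in>E. 2)"
  proof (intro sum.cong refl)
    fix e assume e: "e \<in> E"
    obtain u v where uv: "e = {u, v}" "u \<noteq> v" by (rule looplessE[OF E(2) e])
    have "{..<n} \<inter> {i. i \<in> e} = {u, v}" using uv E(3) e by auto
    then show "(\<Sum>i<n. if i \<in> e then 1 else 0) = (2 :: real)" using uv(2) by (simp add: sum.If_cases)
  qed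
  finally show ?thesis by simp
qed

subsection \<open>Spectral decomposition of real symmetric matrices\<close>

text \<open>Gram--Schmidt on a basis beginning with \<open>v\<close> gives orthogonal vectors, which
  the factors \<open>s\<close> scale to unit length; this is why the first column is only a multiple
  of \<open>v\<close>.\<close>

lemma orthonormal_completion:
  fixes v :: "real vec"
  assumes v: "v \<in> carrier_vec n" and v0: "v \<noteq> 0\<^sub>v n"
  obtains W c where "W \<in> carrier_mat n n" "transpose_mat W * W = 1\<^sub>m n" "col W 0 = c \<cdot>\<^sub>v v"
proof -
  have n: "n \<noteq> 0" using v v0 by (auto simp: vec_eq_iff)
  interpret cof_vec_space n "TYPE(real)" .
  define b where "b = basis_completion v"
  define ws where "ws = gram_schmidt n b"
  from basis_completion[OF v v0, folded b_def]
  have dist_b: "distinct b" and indep: "\<not> lin_dep (set b)" and b: "set b \<subseteq> carrier_vec n"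
    and hdb: "hd b = v" and len_b: "length b = n" by auto
  from hdb len_b n obtain vs where bv: "b = v # vs" by (cases b, auto)
  from gram_schmidt_result[OF b dist_b indep refl, folded ws_def]
  have ws: "set ws \<subseteq> carrier_vec n" "corthogonal ws" "length ws = n"
    by (auto simp: len_b)
  from gram_schmidt_hd[OF v, of vs, folded bv] have hdws: "hd ws = v" unfolding ws_def .
  have wsc: "ws ! i \<in> carrier_vec n" if "i < n" for i using ws that by auto
  have orth: "(ws ! i \<bullet> ws ! j = 0) = (i \<noteq> j)" if "i < n" "j < n" for i j
  proof -
    \<comment> \<open>Over the reals conjugation is the identity, so \<open>corthogonal\<close>
      means ordinary orthogonality.\<close>
    have "conjugate (ws ! j) = ws ! j" by (rule eq_vecI) auto
    then show ?thesis using corthogonalD[OF ws(2), of i j] that ws(3) by simp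
  qed
  define s where "s i = 1 / sqrt (ws ! i \<bullet> ws ! i)" for i
  have pos: "ws ! i \<bullet> ws ! i > 0" if "i < n" for i
  proof -
    have "ws ! i \<bullet> ws ! i \<ge> 0" by (auto simp: scalar_prod_def intro!: sum_nonneg)
    then show ?thesis using orth[OF that that] by simp
  qed
  define W where "W = mat n n (\<lambda>(i,j). s j * (ws ! j) $ i)"
  have W: "W \<in> carrier_mat n n" unfolding W_def by simp
  have "transpose_mat W * W = 1\<^sub>m n"
  proof (rule eq_matI)
    fix i j assume ij: "i < dim_row (1\<^sub>m n)" "j < dim_col (1\<^sub>m n)"
    then have i: "i < n" and j: "j < n" by auto
    have "(transpose_mat W * W) $$ (i,j) = s i * s j * (ws ! i \<bullet> ws ! j)"
    proof -
      have "(transpose_mat W * W) $$ (i,j) = (\<Sum>l<n. (s i * (ws ! i) $ l) * (s j * (ws ! j) $ l))"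
        using i j by (simp add: W_def scalar_prod_def atLeast0LessThan)
      also have "\<dots> = s i * s j * (\<Sum>l<n. (ws ! i) $ l * (ws ! j) $ l)"
        unfolding sum_distrib_left by (intro sum.cong) auto
      finally show ?thesis using wsc[OF j] by (simp add: scalar_prod_def atLeast0LessThan)
    qed
    also have "\<dots> = (if i = j then 1 else 0)"
      using orth[OF i j] pos[OF i] by (cases "i = j") (simp_all add: s_def)
    finally show "(transpose_mat W * W) $$ (i,j) = 1\<^sub>m n $$ (i,j)" using i j by simp
  qed (use W in auto)
  moreover have "col W 0 = s 0 \<cdot>\<^sub>v v"
  proof (rule eq_vecI)
    have "ws ! 0 = v" using hdws ws(3) n by (metis hd_conv_nth list.size(3))
    then show "col W 0 $ i = (s 0 \<cdot>\<^sub>v v) $ i" if "i < dim_vec (s 0 \<cdot>\<^sub>v v)" for i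
      using that v n by (simp add: W_def)
  qed (use v W in auto)
  ultimately show ?thesis using that W by blast
qed

text \<open>Deflation: an orthogonal matrix whose first column is an eigenvector for
  \<open>e\<close> makes \<open>A\<close> block diagonal, and the induction hypothesis applies to
  the smaller block. The diagonal keeps the given order of \<open>es\<close>, so that later the
  first \<open>k\<close> columns belong to the \<open>k\<close> largest eigenvalues.\<close>

lemma symmetric_mat_diagonalization:
  fixes A :: "real mat"
  assumes "A \<in> carrier_mat n n" "transpose_mat A = A"
    and "char_poly A = (\<Prod>e\<leftarrow>es. [:- e, 1:])"
  shows "\<exists>U \<in> carrier_mat n n. transpose_mat U * U = 1\<^sub>m n \<and>
    transpose_mat U * A * U = mat n n (\<lambda>(i,j). if i = j then es ! i else 0)"
  using assms
proof (induct es arbitrary: n A)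
  case Nil
  with degree_monic_char_poly[of A n] have "n = 0" by auto
  then show ?case using Nil by (intro bexI[of _ "1\<^sub>m 0"]) auto
next
  case (Cons e es n A)
  note A = Cons(2) and sym = Cons(3)
  have cp: "char_poly A = [: -e, 1 :] * (\<Prod>e \<leftarrow> es. [:- e, 1:])" using Cons(4) by auto
  have mon: "monic (\<Prod>e\<leftarrow> es. [:- e, 1:])" by (rule monic_prod_list, auto)
  have "Polynomial.degree (char_poly A) = Suc (Polynomial.degree (\<Prod>e\<leftarrow> es. [:- e, 1:]))" unfolding cp
    by (subst degree_mult_eq, insert mon, auto)
  with degree_monic_char_poly[OF A] obtain n1 where n: "n = Suc n1" by (cases n) auto
  have "eigenvalue A e" unfolding eigenvalue_root_char_poly[OF A] cp by simp
  then obtain v where v: "v \<in> carrier_vec n" and v0: "v \<noteq> 0\<^sub>v n" and eigen: "A *\<^sub>v v = e \<cdot>\<^sub>v v"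
    using A unfolding eigenvalue_def eigenvector_def by auto
  obtain W c where W: "W \<in> carrier_mat n n" and WW: "transpose_mat W * W = 1\<^sub>m n"
    and col0: "col W 0 = c \<cdot>\<^sub>v v"
    using orthonormal_completion[OF v v0] .
  have Wt: "transpose_mat W \<in> carrier_mat n n" using W by simp
  have WW': "W * transpose_mat W = 1\<^sub>m n" using mat_mult_left_right_inverse[OF Wt W WW] .
  define A' where "A' = transpose_mat W * A * W"
  have A': "A' \<in> carrier_mat n n" unfolding A'_def using W A by auto
  have symA': "transpose_mat A' = A'"
    unfolding A'_def using W A Wt sym
    by (simp add: transpose_mult[of _ n n _ n] assoc_mult_mat[of _ n n _ n _ n])
  have Ai0: "A' $$ (i, 0) = (if i = 0 then e else 0)" if i: "i < n" for i
  proof -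
    have "A' = transpose_mat W * (A * W)" unfolding A'_def using W A Wt by (simp add: assoc_mult_mat[of _ n n _ n _ n])
    then have "A' $$ (i,0) = col W i \<bullet> (A *\<^sub>v col W 0)"
      using W A i n by (simp add: mult_mat_vec_def)
    also have "A *\<^sub>v col W 0 = e \<cdot>\<^sub>v col W 0"
      unfolding col0 using A v eigen by (simp add: mult_mat_vec smult_smult_assoc mult.commute)
    also have "col W i \<bullet> (e \<cdot>\<^sub>v col W 0) = e * (transpose_mat W * W) $$ (i, 0)"
      using W i n by simp
    also have "\<dots> = (if i = 0 then e else 0)" unfolding WW using i n by simp
    finally show ?thesis .
  qed
  \<comment> \<open>Symmetry carries the zeros of the first column over to the first row.\<close>
  have A0i: "A' $$ (0, i) = (if i = 0 then e else 0)" if i: "i < n" for i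
  proof -
    have "A' $$ (0,i) = transpose_mat A' $$ (0, i)" unfolding symA' ..
    also have "\<dots> = A' $$ (i, 0)" using A' i n by simp
    finally show ?thesis using Ai0[OF i] by simp
  qed
  define A3 where "A3 = mat n1 n1 (\<lambda>(i,j). A' $$ (Suc i, Suc j))"
  define A1 where "A1 = mat 1 1 (\<lambda>_. e)"
  have A3: "A3 \<in> carrier_mat n1 n1" and A1: "A1 \<in> carrier_mat 1 1" by (auto simp: A3_def A1_def)
  have block: "A' = four_block_mat A1 (0\<^sub>m 1 n1) (0\<^sub>m n1 1) A3"
    using A' n Ai0 A0i by (intro eq_matI) (auto simp: A1_def A3_def)
  have symA3: "transpose_mat A3 = A3"
  proof (rule eq_matI)
    fix i j assume "i < dim_row A3" "j < dim_col A3"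
    then have i: "i < n1" and j: "j < n1" using A3 by auto
    have "A' $$ (Suc j, Suc i) = transpose_mat A' $$ (Suc j, Suc i)" unfolding symA' ..
    then show "transpose_mat A3 $$ (i, j) = A3 $$ (i, j)" using i j A' n by (simp add: A3_def)
  qed (use A3 in auto)
  have "similar_mat_wit A' A (transpose_mat W) W"
    by (rule similar_mat_witI[of _ _ n]) (use W Wt A A' WW WW' in \<open>auto simp: A'_def\<close>)
  then have "char_poly A' = char_poly A"
    by (intro char_poly_similar) (auto simp: similar_mat_def)
  moreover have "char_poly A' = char_poly A1 * char_poly A3"
    unfolding block by (rule char_poly_four_block_zeros_col[OF A1 _ A3]) auto
  moreover have "char_poly A1 = [: -e,1 :]"
    by (simp add: A1_def char_poly_defs det_def sign_def)
  ultimately have "char_poly A3 = (\<Prod> e \<leftarrow> es. [:- e, 1:])"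
    using cp by (metis mult_cancel_left pCons_eq_0_iff zero_neq_one)
  from Cons(1)[OF A3 symA3 this] obtain U3 where U3: "U3 \<in> carrier_mat n1 n1"
    and UU3: "transpose_mat U3 * U3 = 1\<^sub>m n1"
    and diag3: "transpose_mat U3 * A3 * U3 = mat n1 n1 (\<lambda>(i,j). if i = j then es ! i else 0)"
    by auto
  define F where "F = four_block_mat (1\<^sub>m 1) (0\<^sub>m 1 n1) (0\<^sub>m n1 1) U3"
  have F: "F \<in> carrier_mat n n" unfolding F_def using U3 n four_block_carrier_mat[of "1\<^sub>m 1" 1 1 U3 n1 n1] by auto
  have Ft: "transpose_mat F = four_block_mat (1\<^sub>m 1) (0\<^sub>m 1 n1) (0\<^sub>m n1 1) (transpose_mat U3)"
    unfolding F_def by (subst transpose_four_block_mat[of _ 1 1 _ n1 _ n1]) (use U3 in auto)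
  have FF: "transpose_mat F * F = 1\<^sub>m n"
    unfolding Ft unfolding F_def using U3 UU3 n
    by (subst mult_four_block_mat[of _ 1 1 _ n1 _ n1 _ _ 1 _ n1])
       (auto intro!: eq_matI)
  have FAF: "transpose_mat F * A' * F = mat n n (\<lambda>(i,j). if i = j then (e # es) ! i else 0)"
  proof -
    have "transpose_mat F * A' * F = four_block_mat A1 (0\<^sub>m 1 n1) (0\<^sub>m n1 1) (transpose_mat U3 * A3 * U3)"
      unfolding Ft block unfolding F_def using U3 A3 A1
      by (subst mult_four_block_mat[of _ 1 1 _ n1 _ n1 _ _ 1 _ n1], simp_all,
          subst mult_four_block_mat[of _ 1 1 _ n1 _ n1 _ _ 1 _ n1], simp_all)
    also have "\<dots> = mat n n (\<lambda>(i,j). if i = j then (e # es) ! i else 0)"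
      unfolding diag3 using n by (intro eq_matI) (auto simp: A1_def nth_Cons')
    finally show ?thesis .
  qed
  let ?U = "W * F"
  have "transpose_mat ?U * ?U = transpose_mat F * (transpose_mat W * W) * F"
    using W F by (simp add: transpose_mult[of _ n n _ n] assoc_mult_mat[of _ n n _ n _ n])
  also have "\<dots> = 1\<^sub>m n" unfolding WW using F FF by simp
  finally have 1: "transpose_mat ?U * ?U = 1\<^sub>m n" .
  have "transpose_mat ?U * A * ?U = transpose_mat F * A' * F"
    unfolding A'_def using W F A by (simp add: transpose_mult[of _ n n _ n] assoc_mult_mat[of _ n n _ n _ n])
  then have 2: "transpose_mat ?U * A * ?U = mat n n (\<lambda>(i,j). if i = j then (e # es) ! i else 0)"
    using FAF by simp
  show ?case using W F 1 2 by (intro bexI[of _ ?U]) auto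
qed

text \<open>Over the complex numbers the polynomial splits, and every root \<open>a\<close> has an
  eigenvector v. The number v^* A v = a |v|^2 equals its own conjugate because \<open>A\<close> is
  real and symmetric; as |v|^2 is real and nonzero, \<open>a\<close> is real.\<close>

lemma symmetric_char_poly_splits:
  fixes A :: "real mat"
  assumes A: "A \<in> carrier_mat n n" and sym: "transpose_mat A = A"
  obtains es where "char_poly A = (\<Prod>e\<leftarrow>es. [:- e, 1:])"
proof -
  let ?C = "map_mat complex_of_real A"
  have C: "?C \<in> carrier_mat n n" using A by simp
  obtain as where as: "char_poly ?C = (\<Prod>a\<leftarrow>as. [:- a, 1:])"
    using char_poly_factorized[OF C] by auto
  have real: "complex_of_real (Re a) = a" if a: "a \<in> set as" for a
  proof -
    have "poly (char_poly ?C) a = 0" unfolding as using a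
      by (auto simp: poly_prod_list prod_list_zero_iff)
    then have "eigenvalue ?C a" using eigenvalue_root_char_poly[OF C] by simp
    then obtain v where v: "v \<in> carrier_vec n" and v0: "v \<noteq> 0\<^sub>v n" and ev: "?C *\<^sub>v v = a \<cdot>\<^sub>v v"
      using A unfolding eigenvalue_def eigenvector_def by auto
    have Aij: "A $$ (i,j) = A $$ (j,i)" if "i < n" "j < n" for i j
    proof -
      have "A $$ (i,j) = transpose_mat A $$ (i,j)" unfolding sym ..
      then show ?thesis using that A by simp
    qed
    have row: "(\<Sum>j<n. complex_of_real (A $$ (i,j)) * v $ j) = a * v $ i" if "i < n" for i
      using arg_cong[OF ev, of "\<lambda>w. w $ i"] that A v
      by (simp add: scalar_prod_def atLeast0LessThan)
    define N where "N = (\<Sum>i<n. v $ i * cnj (v $ i))"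
    have N: "N = complex_of_real (\<Sum>i<n. (cmod (v $ i))\<^sup>2)"
      unfolding N_def of_real_sum by (simp only: complex_norm_square)
    have "a * N = (\<Sum>i<n. cnj (v $ i) * (a * v $ i))" unfolding N_def sum_distrib_left
      by (simp add: mult_ac)
    also have "\<dots> = (\<Sum>i<n. \<Sum>j<n. cnj (v $ i) * complex_of_real (A $$ (i,j)) * v $ j)"
      by (intro sum.cong refl) (simp add: row[symmetric] sum_distrib_left mult.assoc)
    finally have 1: "a * N = (\<Sum>i<n. \<Sum>j<n. cnj (v $ i) * complex_of_real (A $$ (i,j)) * v $ j)" .
    have "cnj (a * N) = (\<Sum>i<n. \<Sum>j<n. v $ i * complex_of_real (A $$ (i,j)) * cnj (v $ j))"
      unfolding 1 by simp
    also have "\<dots> = (\<Sum>j<n. \<Sum>i<n. v $ i * complex_of_real (A $$ (i,j)) * cnj (v $ j))"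
      by (rule sum.swap)
    also have "\<dots> = a * N" unfolding 1 by (intro sum.cong refl) (simp add: Aij mult_ac)
    finally have "cnj (a * N) = a * N" .
    moreover have "cnj N = N" unfolding N by simp
    moreover have "N \<noteq> 0"
    proof
      assume "N = 0"
      then have "(\<Sum>i<n. (cmod (v $ i))\<^sup>2) = 0" unfolding N by (simp only: of_real_eq_0_iff)
      then have "\<forall>i<n. v $ i = 0" by (simp add: sum_nonneg_eq_0_iff)
      then show False using v v0 by (auto simp: vec_eq_iff)
    qed
    ultimately have "cnj a = a" by simp
    then show ?thesis by (metis Reals_cnj_iff of_real_Re)
  qed
  let ?es = "map Re as"
  interpret h: map_poly_inj_idom_hom complex_of_real ..
  have map: "map_poly complex_of_real (\<Prod>e\<leftarrow>map Re bs. [:- e, 1:]) = (\<Prod>a\<leftarrow>bs. [:- a, 1:])"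
    if "set bs \<subseteq> set as" for bs
    using that by (induct bs) (auto simp: h.hom_mult real simp del: mult_pCons_left mult_pCons_right)
  \<comment> \<open>Both real polynomials have the same image over the complex numbers, and the
    embedding is injective.\<close>
  have "map_poly complex_of_real (char_poly A) = map_poly complex_of_real (\<Prod>e\<leftarrow>?es. [:- e, 1:])"
    unfolding map[OF order.refl] of_real_hom.char_poly_hom[OF A, symmetric] as ..
  then have "char_poly A = (\<Prod>e\<leftarrow>?es. [:- e, 1:])"
    by (rule h.injectivity)
  then show ?thesis using that by blast
qed

text \<open>\<open>proots\<close> collects real roots only. That none is missing, and hence that the
  list has \<open>n\<close> entries, comes from the splitting over the reals.\<close>

lemma char_poly_eigenvalues_desc:
  fixes A :: "real mat"
  assumes A: "A \<in> carrier_mat n n" and sym: "transpose_mat A = A"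
  shows "char_poly A = (\<Prod>e\<leftarrow>eigenvalues_desc A. [:- e, 1:])" "length (eigenvalues_desc A) = n"
proof -
  obtain es where es: "char_poly A = (\<Prod>e\<leftarrow>es. [:- e, 1:])"
    using symmetric_char_poly_splits[OF A sym] .
  have "proots (\<Prod>e\<leftarrow>es. [:- e, 1:]) = mset es"
  proof (induct es)
    case (Cons e es)
    have "(\<Prod>e\<leftarrow>es. [:- e, 1:]) \<noteq> 0" by (auto simp: prod_list_zero_iff)
    then show ?case using Cons by (simp add: proots_mult del: mult_pCons_left)
  qed simp
  then have mset: "mset (eigenvalues_desc A) = mset es"
    unfolding eigenvalues_desc_def es by simp
  have "(\<Prod>e\<leftarrow>eigenvalues_desc A. [:- e, 1:]) = \<Prod>\<^sub># (image_mset (\<lambda>e. [:- e, 1:]) (mset (eigenvalues_desc A)))"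
    by (simp only: mset_map[symmetric] prod_mset_prod_list)
  also have "\<dots> = (\<Prod>e\<leftarrow>es. [:- e, 1:])"
    by (simp only: mset mset_map[symmetric] prod_mset_prod_list)
  finally show cp: "char_poly A = (\<Prod>e\<leftarrow>eigenvalues_desc A. [:- e, 1:])" using es by simp
  have "Polynomial.degree (\<Prod>e\<leftarrow>xs. [:- e, 1::real:]) = length xs" for xs
    by (rule degree_linear_factors)
  then show "length (eigenvalues_desc A) = n" using degree_monic_char_poly[OF A] cp by metis
qed

text \<open>The entrywise form of A = U D U^T, with which later traces are rearranged by exchanging
  finite sums.\<close>

lemma spectral_decomposition:
  fixes A :: "real mat"
  assumes A: "A \<in> carrier_mat n n" and sym: "transpose_mat A = A"
  obtains U :: "nat \<Rightarrow> nat \<Rightarrow> real" where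
    "\<And>i j. i < n \<Longrightarrow> j < n \<Longrightarrow> (\<Sum>l<n. U l i * U l j) = (if i = j then 1 else 0)"
    "\<And>i j. i < n \<Longrightarrow> j < n \<Longrightarrow> (\<Sum>l<n. U i l * U j l) = (if i = j then 1 else 0)"
    "\<And>i j. i < n \<Longrightarrow> j < n \<Longrightarrow> A $$ (i,j) = (\<Sum>l<n. eigenvalues_desc A ! l * U i l * U j l)"
proof -
  obtain V where V: "V \<in> carrier_mat n n" and VV: "transpose_mat V * V = 1\<^sub>m n"
    and D: "transpose_mat V * A * V = mat n n (\<lambda>(i,j). if i = j then eigenvalues_desc A ! i else 0)"
    using symmetric_mat_diagonalization[OF A sym char_poly_eigenvalues_desc(1)[OF A sym]] by auto
  have Vt: "transpose_mat V \<in> carrier_mat n n" using V by simp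
  have VV': "V * transpose_mat V = 1\<^sub>m n" using mat_mult_left_right_inverse[OF Vt V VV] .
  define U where "U i j = V $$ (i,j)" for i j
  let ?D = "mat n n (\<lambda>(i,j). if i = j then eigenvalues_desc A ! i else 0)"
  have 1: "(\<Sum>l<n. U l i * U l j) = (if i = j then 1 else 0)" if "i < n" "j < n" for i j
    using arg_cong[OF VV, of "\<lambda>M. M $$ (i,j)"] that V
    by (simp add: scalar_prod_def U_def atLeast0LessThan)
  have 2: "(\<Sum>l<n. U i l * U j l) = (if i = j then 1 else 0)" if "i < n" "j < n" for i j
    using arg_cong[OF VV', of "\<lambda>M. M $$ (i,j)"] that V
    by (simp add: scalar_prod_def U_def atLeast0LessThan)
  have "V * ?D * transpose_mat V = (V * transpose_mat V) * A * (V * transpose_mat V)"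
    unfolding D[symmetric] using V Vt A by (simp add: assoc_mult_mat[of _ n n _ n _ n])
  also have "\<dots> = A" unfolding VV' using A by simp
  finally have A_eq: "A = V * ?D * transpose_mat V" by simp
  have 3: "A $$ (i,j) = (\<Sum>l<n. eigenvalues_desc A ! l * U i l * U j l)" if ij: "i < n" "j < n" for i j
  proof -
    have "(V * ?D) $$ (i,l) = eigenvalues_desc A ! l * U i l" if "l < n" for l
    proof -
      have "(V * ?D) $$ (i,l) = (\<Sum>h<n. V $$ (i,h) * (if h = l then eigenvalues_desc A ! h else 0))"
        using V ij that by (simp add: scalar_prod_def atLeast0LessThan)
      also have "\<dots> = (\<Sum>h<n. if h = l then eigenvalues_desc A ! h * V $$ (i,h) else 0)"
        by (intro sum.cong) auto
      finally show ?thesis using that by (simp add: U_def)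
    qed
    then have "(\<Sum>l<n. (V * ?D) $$ (i,l) * V $$ (j,l)) = (\<Sum>l<n. eigenvalues_desc A ! l * U i l * U j l)"
      by (intro sum.cong) (auto simp: U_def)
    moreover have "(V * ?D * transpose_mat V) $$ (i,j) = (\<Sum>l<n. (V * ?D) $$ (i,l) * V $$ (j,l))"
      using V ij by (subst index_mult_mat(1)) (auto simp: scalar_prod_def atLeast0LessThan intro!: sum.cong)
    ultimately show ?thesis using A_eq by metis
  qed
  show ?thesis using that 1 2 3 by blast
qed

subsection \<open>Orthogonal projections\<close>

text \<open>The trace of an idempotent matrix is its rank, so the last conjunct says that the rank
  is \<open>k\<close>. Only entries with indices below \<open>n\<close> are constrained.\<close>

definition orth_proj :: "nat \<Rightarrow> nat \<Rightarrow> (nat \<Rightarrow> nat \<Rightarrow> real) \<Rightarrow> bool" where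
  "orth_proj n k P \<longleftrightarrow>
    (\<forall>i<n. \<forall>j<n. P i j = P j i) \<and>
    (\<forall>i<n. \<forall>j<n. (\<Sum>l<n. P i l * P l j) = P i j) \<and>
    (\<Sum>i<n. P i i) = real k"

lemma orth_projD:
  assumes "orth_proj n k P"
  shows "i < n \<Longrightarrow> j < n \<Longrightarrow> P i j = P j i"
    and "i < n \<Longrightarrow> j < n \<Longrightarrow> (\<Sum>l<n. P i l * P l j) = P i j"
    and "i < n \<Longrightarrow> j < n \<Longrightarrow> (\<Sum>l<n. P l i * P l j) = P i j"
    and "(\<Sum>i<n. P i i) = real k"
proof -
  show sym: "P i j = P j i" if "i < n" "j < n" for i j
    using assms that unfolding orth_proj_def by blast
  show sq: "(\<Sum>l<n. P i l * P l j) = P i j" if "i < n" "j < n" for i j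
    using assms that unfolding orth_proj_def by blast
  show "(\<Sum>l<n. P l i * P l j) = P i j" if "i < n" "j < n" for i j
    unfolding sq[OF that, symmetric] using that by (intro sum.cong) (auto simp: sym)
  show "(\<Sum>i<n. P i i) = real k"
    using assms unfolding orth_proj_def by blast
qed

text \<open>Serves twice: positivity of I - P yields \<open>orth_proj_quadratic_le\<close>, and its
  rank yields the forest bound with \<open>n - k\<close>.\<close>

lemma orth_proj_complement:
  assumes P: "orth_proj n k P" and k: "k \<le> n"
  shows "orth_proj n (n - k) (\<lambda>i j. (if i = j then 1 else 0) - P i j)"
  unfolding orth_proj_def
proof (intro conjI allI impI)
  fix i j assume ij: "i < n" "j < n"
  have "(\<Sum>l<n. ((if i = l then 1 else 0) - P i l) * ((if l = j then 1 else 0) - P l j))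
      = (\<Sum>l<n. (if i = l then (if l = j then 1 else 0) - P l j else 0))
        - (\<Sum>l<n. (if l = j then P i l else 0)) + (\<Sum>l<n. P i l * P l j)"
    unfolding sum_subtractf[symmetric] sum.distrib[symmetric]
    by (intro sum.cong refl) (auto simp: algebra_simps)
  also have "\<dots> = (if i = j then 1 else 0) - P i j"
    using ij by (simp add: orth_projD(2)[OF P])
  finally show "(\<Sum>l<n. ((if i = l then 1 else 0) - P i l) * ((if l = j then 1 else 0) - P l j))
    = (if i = j then 1 else 0) - P i j" .
qed (use k in \<open>auto simp: orth_projD(1)[OF P] sum_subtractf orth_projD(4)[OF P] of_nat_diff\<close>)

text \<open>P = P^T P, hence x^T P x = |P x|^2.\<close>

lemma orth_proj_quadratic:
  assumes P: "orth_proj n k P"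
  shows "(\<Sum>i<n. \<Sum>j<n. P i j * x i * x j) = (\<Sum>l<n. (\<Sum>i<n. P l i * x i)\<^sup>2)"
proof -
  have "(\<Sum>l<n. (\<Sum>i<n. P l i * x i)\<^sup>2) = (\<Sum>l<n. \<Sum>i<n. \<Sum>j<n. P l i * P l j * x i * x j)"
    by (simp add: power2_eq_square sum_product mult_ac)
  also have "\<dots> = (\<Sum>i<n. \<Sum>l<n. \<Sum>j<n. P l i * P l j * x i * x j)" by (rule sum.swap)
  also have "\<dots> = (\<Sum>i<n. \<Sum>j<n. \<Sum>l<n. P l i * P l j * x i * x j)"
    by (intro sum.cong refl sum.swap)
  also have "\<dots> = (\<Sum>i<n. \<Sum>j<n. P i j * x i * x j)"
    by (intro sum.cong refl)
       (simp add: sum_distrib_right[symmetric] orth_projD(3)[OF P])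
  finally show ?thesis ..
qed

lemma orth_proj_quadratic_nonneg:
  assumes "orth_proj n k P"
  shows "0 \<le> (\<Sum>i<n. \<Sum>j<n. P i j * x i * x j)"
  unfolding orth_proj_quadratic[OF assms] by (intro sum_nonneg) auto

lemma orth_proj_quadratic_le:
  assumes P: "orth_proj n k P" and k: "k \<le> n"
  shows "(\<Sum>i<n. \<Sum>j<n. P i j * x i * x j) \<le> (\<Sum>i<n. (x i)\<^sup>2)"
proof -
  have "0 \<le> (\<Sum>i<n. \<Sum>j<n. ((if i = j then 1 else 0) - P i j) * x i * x j)"
    by (rule orth_proj_quadratic_nonneg[OF orth_proj_complement[OF P k]])
  also have "\<dots> = (\<Sum>i<n. (\<Sum>j<n. if i = j then x i * x j else 0) - (\<Sum>j<n. P i j * x i * x j))"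
    unfolding sum_subtractf[symmetric] by (intro sum.cong refl) (auto simp: algebra_simps)
  also have "\<dots> = (\<Sum>i<n. (x i)\<^sup>2) - (\<Sum>i<n. \<Sum>j<n. P i j * x i * x j)"
    by (simp add: sum_subtractf power2_eq_square)
  finally show ?thesis by simp
qed

lemma orth_proj_diag:
  assumes P: "orth_proj n k P" and k: "k \<le> n" and i: "i < n"
  shows "0 \<le> P i i" "P i i \<le> 1"
proof -
  let ?x = "\<lambda>j. if j = i then 1 else 0 :: real"
  have "(\<Sum>a<n. \<Sum>b<n. P a b * ?x a * ?x b) = (\<Sum>a<n. \<Sum>b<n. if b = i then P a b * ?x a else 0)"
    by (intro sum.cong refl) auto
  also have "\<dots> = (\<Sum>a<n. if a = i then P a i else 0)"
    using i by (intro sum.cong refl) auto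
  also have "\<dots> = P i i" using i by simp
  finally have eq: "(\<Sum>a<n. \<Sum>b<n. P a b * ?x a * ?x b) = P i i" .
  have "(\<Sum>a<n. (?x a)\<^sup>2) = (\<Sum>a<n. ?x a)" by (intro sum.cong) auto
  then have "(\<Sum>a<n. (?x a)\<^sup>2) = 1" using i by simp
  then show "0 \<le> P i i" "P i i \<le> 1"
    using orth_proj_quadratic_nonneg[OF P, of ?x] orth_proj_quadratic_le[OF P k, of ?x] eq by auto
qed

text \<open>Polarisation: 4 x^T P y is the difference of the quadratic forms at x + y and x - y. The
  first is at most |x + y|^2, the second is nonnegative.\<close>

lemma orth_proj_bilinear_le:
  assumes P: "orth_proj n k P" and k: "k \<le> n"
  shows "4 * (\<Sum>i<n. \<Sum>j<n. P i j * x i * y j) \<le> (\<Sum>i<n. (x i + y i)\<^sup>2)"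
proof -
  have swap: "(\<Sum>i<n. \<Sum>j<n. P i j * y i * x j) = (\<Sum>i<n. \<Sum>j<n. P i j * x i * y j)"
    by (subst sum.swap, intro sum.cong refl) (auto simp: orth_projD(1)[OF P])
  have "(\<Sum>i<n. \<Sum>j<n. P i j * (x i + y i) * (x j + y j)) - (\<Sum>i<n. \<Sum>j<n. P i j * (x i - y i) * (x j - y j))
    = 2 * (\<Sum>i<n. \<Sum>j<n. P i j * x i * y j) + 2 * (\<Sum>i<n. \<Sum>j<n. P i j * y i * x j)"
    unfolding sum_subtractf[symmetric] sum_distrib_left sum.distrib[symmetric]
    by (intro sum.cong refl) (simp add: algebra_simps)
  then show ?thesis
    using orth_proj_quadratic_le[OF P k, of "\<lambda>i. x i + y i"]
      orth_proj_quadratic_nonneg[OF P, of "\<lambda>i. x i - y i"] swap by simp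
qed

text \<open>The left side is the trace of P against the adjacency matrix of a star with centre
  \<open>c\<close> and leaf set \<open>L\<close>. In \<open>orth_proj_bilinear_le\<close>, x is r
  times the unit vector at \<open>c\<close> and y the indicator of \<open>L\<close>. With r^2 = |L|
  both have the same norm, and their supports are disjoint, so 4 r times the sum of the P c j is at
  most 2 r^2.\<close>

lemma orth_proj_star_le:
  assumes P: "orth_proj n k P" and k: "k \<le> n"
    and c: "c < n" and L: "L \<subseteq> {..<n}" and cL: "c \<notin> L"
  shows "2 * (\<Sum>j\<in>L. P c j) \<le> sqrt (card L)"
proof (cases "L = {}")
  case False
  have finL: "finite L" using L finite_subset by blast
  define r where "r = sqrt (card L)"
  have r: "r > 0" "r\<^sup>2 = card L" using False finL by (auto simp: r_def card_gt_0_iff)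
  let ?x = "\<lambda>i. if i = c then r else 0"
  let ?y = "\<lambda>j. if j \<in> L then 1 else 0 :: real"
  have "(\<Sum>i<n. \<Sum>j<n. P i j * ?x i * ?y j) = (\<Sum>i<n. if i = c then r * (\<Sum>j<n. P i j * ?y j) else 0)"
    by (intro sum.cong refl) (auto simp: sum_distrib_left mult_ac intro!: sum.cong)
  also have "\<dots> = r * (\<Sum>j<n. P c j * ?y j)" using c by simp
  also have "(\<Sum>j<n. P c j * ?y j) = (\<Sum>j\<in>L. P c j)"
    using L by (intro sum.mono_neutral_cong_right) auto
  finally have 1: "(\<Sum>i<n. \<Sum>j<n. P i j * ?x i * ?y j) = r * (\<Sum>j\<in>L. P c j)" .
  have "(\<Sum>i<n. (?x i + ?y i)\<^sup>2) = (\<Sum>i<n. (if i = c then r\<^sup>2 else 0)) + (\<Sum>i<n. ?y i)"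
    unfolding sum.distrib[symmetric] using cL by (intro sum.cong) auto
  also have "(\<Sum>i<n. ?y i) = (\<Sum>i\<in>L. 1)"
    using L by (intro sum.mono_neutral_cong_right) auto
  finally have 2: "(\<Sum>i<n. (?x i + ?y i)\<^sup>2) = 2 * r\<^sup>2" using c r by simp
  from orth_proj_bilinear_le[OF P k, of ?x ?y] have "r * (2 * (\<Sum>j\<in>L. P c j)) \<le> r * r"
    unfolding 1 2 by (simp add: power2_eq_square)
  then show ?thesis using r by (simp add: r_def[symmetric])
qed simp

lemma orth_proj_off_diag_le:
  assumes P: "orth_proj n k P" and k: "k \<le> n" and ij: "i < n" "j < n" "i \<noteq> j"
  shows "P i j \<le> 1/2"
  using orth_proj_star_le[OF P k, of i "{j}"] ij by simp

lemma orth_proj_weighted_diag_le: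
  assumes P: "orth_proj n k P" and k: "k \<le> n" and d: "\<And>i. i < n \<Longrightarrow> 1 \<le> d i"
  shows "(\<Sum>i<n. P i i * d i) \<le> real k + (\<Sum>i<n. d i - 1)"
proof -
  have "P i i * (d i - 1) \<le> d i - 1" if "i < n" for i
    using mult_right_mono[OF orth_proj_diag(2)[OF P k that], of "d i - 1"] d[OF that] by simp
  then have "P i i * d i \<le> P i i + (d i - 1)" if "i < n" for i
    using that by (fastforce simp: algebra_simps)
  then have "(\<Sum>i<n. P i i * d i) \<le> (\<Sum>i<n. P i i + (d i - 1))" by (intro sum_mono) auto
  also have "\<dots> = real k + (\<Sum>i<n. d i - 1)" by (simp add: sum.distrib orth_projD(4)[OF P])
  finally show ?thesis .
qed

text \<open>Lagrange's identity: the squares of a_i b_j - a_j b_i add up to twice the difference of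
  the two sides.\<close>

lemma Cauchy_Schwarz_sum:
  fixes a b :: "'a \<Rightarrow> real"
  shows "(\<Sum>i\<in>I. a i * b i)\<^sup>2 \<le> (\<Sum>i\<in>I. (a i)\<^sup>2) * (\<Sum>i\<in>I. (b i)\<^sup>2)"
proof -
  have "0 \<le> (\<Sum>i\<in>I. \<Sum>j\<in>I. (a i * b j - a j * b i)\<^sup>2)" by (intro sum_nonneg) auto
  also have "\<dots> = (\<Sum>i\<in>I. \<Sum>j\<in>I. (a i)\<^sup>2 * (b j)\<^sup>2) + (\<Sum>i\<in>I. \<Sum>j\<in>I. (b i)\<^sup>2 * (a j)\<^sup>2)
      - 2 * (\<Sum>i\<in>I. \<Sum>j\<in>I. (a i * b i) * (a j * b j))"
    unfolding sum_subtractf[symmetric] sum_distrib_left sum.distrib[symmetric]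
    by (intro sum.cong refl) (simp add: power2_eq_square algebra_simps)
  also have "\<dots> = 2 * ((\<Sum>i\<in>I. (a i)\<^sup>2) * (\<Sum>i\<in>I. (b i)\<^sup>2)) - 2 * (\<Sum>i\<in>I. a i * b i)\<^sup>2"
    unfolding sum_product[symmetric] power2_eq_square[of "sum _ _"] by simp
  finally show ?thesis by simp
qed

lemma orth_proj_frobenius:
  assumes P: "orth_proj n k P"
  shows "(\<Sum>i<n. \<Sum>j<n. (P i j)\<^sup>2) = real k"
proof -
  have "(\<Sum>i<n. \<Sum>j<n. (P i j)\<^sup>2) = (\<Sum>i<n. \<Sum>j<n. P i j * P j i)"
    by (intro sum.cong refl) (auto simp: power2_eq_square orth_projD(1)[OF P])
  also have "\<dots> = real k" using orth_projD(2,4)[OF P] by simp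
  finally show ?thesis .
qed

text \<open>With S = diag(s) the sum is tr(S P S P), which by P^2 = P is the squared Frobenius norm
  of P S P. For signs s_i it says that the entries of P between the two sign classes weigh at most
  as much as those inside them.\<close>

lemma orth_proj_signed_frobenius_nonneg:
  assumes P: "orth_proj n k P"
  shows "0 \<le> (\<Sum>i<n. \<Sum>j<n. s i * s j * (P i j)\<^sup>2)"
proof -
  have "(\<Sum>i<n. \<Sum>j<n. (\<Sum>l<n. P i l * s l * P l j)\<^sup>2)
    = (\<Sum>i<n. \<Sum>j<n. \<Sum>l<n. \<Sum>m<n. s l * s m * (P i l * P i m) * (P l j * P m j))"
    by (simp add: power2_eq_square sum_product mult_ac)
  also have "\<dots> = (\<Sum>i<n. \<Sum>l<n. \<Sum>j<n. \<Sum>m<n. s l * s m * (P i l * P i m) * (P l j * P m j))"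
    by (intro sum.cong refl sum.swap)
  also have "\<dots> = (\<Sum>l<n. \<Sum>i<n. \<Sum>j<n. \<Sum>m<n. s l * s m * (P i l * P i m) * (P l j * P m j))"
    by (rule sum.swap)
  also have "\<dots> = (\<Sum>l<n. \<Sum>i<n. \<Sum>m<n. \<Sum>j<n. s l * s m * (P i l * P i m) * (P l j * P m j))"
    by (intro sum.cong refl sum.swap)
  also have "\<dots> = (\<Sum>l<n. \<Sum>m<n. \<Sum>i<n. \<Sum>j<n. s l * s m * (P i l * P i m) * (P l j * P m j))"
    by (intro sum.cong refl sum.swap)
  also have "\<dots> = (\<Sum>l<n. \<Sum>m<n. s l * s m * (P l m)\<^sup>2)"
  proof (intro sum.cong refl)
    fix l m assume "l \<in> {..<n}" "m \<in> {..<n}"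
    then have lm: "l < n" "m < n" by auto
    have "(\<Sum>i<n. \<Sum>j<n. s l * s m * (P i l * P i m) * (P l j * P m j))
      = s l * s m * ((\<Sum>i<n. P i l * P i m) * (\<Sum>j<n. P l j * P m j))"
      by (subst sum_product) (simp add: sum_distrib_left mult_ac)
    also have "(\<Sum>j<n. P l j * P m j) = P l m"
      unfolding orth_projD(2)[OF P lm, symmetric]
      using lm by (intro sum.cong) (auto simp: orth_projD(1)[OF P])
    finally show "(\<Sum>i<n. \<Sum>j<n. s l * s m * (P i l * P i m) * (P l j * P m j)) = s l * s m * (P l m)\<^sup>2"
      by (simp add: orth_projD(3)[OF P lm] power2_eq_square)
  qed
  finally show ?thesis by (metis (no_types, lifting) sum_nonneg zero_le_power2)
qed

text \<open>Cauchy--Schwarz for \<open>a\<close> and the part \<open>R\<close> of P between the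
  colour classes, whose squared norm is at most half that of P. The factor 2 in the hypothesis
  reflects that an edge gives two entries. The absolute value allows the use with I - P, where the
  sign is reversed.\<close>

lemma orth_proj_bipartite_le:
  fixes f :: "nat \<Rightarrow> bool"
  assumes P: "orth_proj n k P"
    and f: "\<And>i j. i < n \<Longrightarrow> j < n \<Longrightarrow> f i = f j \<Longrightarrow> a i j = 0"
    and a: "(\<Sum>i<n. \<Sum>j<n. (a i j)\<^sup>2) \<le> 2 * t"
  shows "\<bar>\<Sum>i<n. \<Sum>j<n. P i j * a i j\<bar> \<le> sqrt (real k * t)"
proof -
  define s where "s i = (if f i then 1 else -1 :: real)" for i
  define R where "R i j = (if f i = f j then 0 else P i j)" for i j
  \<comment> \<open>The factor 1 - s_i s_j is 2 between the colour classes and 0 inside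
    them.\<close>
  have "(\<Sum>i<n. \<Sum>j<n. (R i j)\<^sup>2) = (\<Sum>i<n. \<Sum>j<n. ((P i j)\<^sup>2 - s i * s j * (P i j)\<^sup>2) / 2)"
    by (intro sum.cong refl) (auto simp: R_def s_def)
  also have "\<dots> = ((\<Sum>i<n. \<Sum>j<n. (P i j)\<^sup>2) - (\<Sum>i<n. \<Sum>j<n. s i * s j * (P i j)\<^sup>2)) / 2"
    by (simp add: sum_subtractf sum_divide_distrib diff_divide_distrib)
  also have "\<dots> \<le> real k / 2"
    using orth_proj_frobenius[OF P] orth_proj_signed_frobenius_nonneg[OF P, of s] by simp
  finally have R: "(\<Sum>i<n. \<Sum>j<n. (R i j)\<^sup>2) \<le> real k / 2" .
  have "(\<Sum>i<n. \<Sum>j<n. P i j * a i j) = (\<Sum>i<n. \<Sum>j<n. R i j * a i j)"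
    by (intro sum.cong refl) (auto simp: R_def f)
  also have "\<dots>\<^sup>2 \<le> (\<Sum>i<n. \<Sum>j<n. (R i j)\<^sup>2) * (\<Sum>i<n. \<Sum>j<n. (a i j)\<^sup>2)"
    using Cauchy_Schwarz_sum[of "\<lambda>(i,j). R i j" "\<lambda>(i,j). a i j" "{..<n} \<times> {..<n}"]
    by (simp add: sum.cartesian_product case_prod_unfold)
  also have "\<dots> \<le> (real k / 2) * (2 * t)"
    using R a by (intro mult_mono) (auto intro!: sum_nonneg)
  finally have "(\<Sum>i<n. \<Sum>j<n. P i j * a i j)\<^sup>2 \<le> real k * t" by simp
  from real_sqrt_le_mono[OF this] show ?thesis by simp
qed

lemma S_k_orth_proj:
  fixes A :: "real mat"
  assumes A: "A \<in> carrier_mat n n" and sym: "transpose_mat A = A" and k: "k \<le> n"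
  obtains P where "orth_proj n k P" "S_k k A = (\<Sum>i<n. \<Sum>j<n. P i j * A $$ (i,j))"
proof -
  let ?\<mu> = "\<lambda>l. eigenvalues_desc A ! l"
  obtain U :: "nat \<Rightarrow> nat \<Rightarrow> real" where
    U: "\<And>i j. i < n \<Longrightarrow> j < n \<Longrightarrow> (\<Sum>l<n. U l i * U l j) = (if i = j then 1 else 0)"
    and AU: "\<And>i j. i < n \<Longrightarrow> j < n \<Longrightarrow> A $$ (i,j) = (\<Sum>l<n. ?\<mu> l * U i l * U j l)"
    by (rule spectral_decomposition[OF A sym]) blast
  \<comment> \<open>Projection onto the span of the first \<open>k\<close> columns of
    \<open>U\<close>; the order of \<open>eigenvalues_desc\<close> makes their eigenvalues the
    \<open>k\<close> largest.\<close>
  define P where "P i j = (\<Sum>l<k. U i l * U j l)" for i j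
  have "orth_proj n k P"
    unfolding orth_proj_def
  proof (intro conjI allI impI)
    fix i j assume "i < n" "j < n"
    show "P i j = P j i" unfolding P_def by (simp add: mult.commute)
    have "(\<Sum>l<n. P i l * P l j) = (\<Sum>l<n. \<Sum>h<k. \<Sum>m<k. U i h * U j m * (U l h * U l m))"
      unfolding P_def sum_product by (intro sum.cong refl) (simp only: mult_ac)
    also have "\<dots> = (\<Sum>h<k. \<Sum>l<n. \<Sum>m<k. U i h * U j m * (U l h * U l m))" by (rule sum.swap)
    also have "\<dots> = (\<Sum>h<k. \<Sum>m<k. \<Sum>l<n. U i h * U j m * (U l h * U l m))"
      by (intro sum.cong refl sum.swap)
    also have "\<dots> = (\<Sum>h<k. \<Sum>m<k. if h = m then U i h * U j m else 0)"
      unfolding sum_distrib_left[symmetric] using k by (intro sum.cong refl) (auto simp: U)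
    also have "\<dots> = P i j" unfolding P_def by simp
    finally show "(\<Sum>l<n. P i l * P l j) = P i j" .
  next
    have "(\<Sum>i<n. P i i) = (\<Sum>l<k. \<Sum>i<n. U i l * U i l)" unfolding P_def by (rule sum.swap)
    also have "\<dots> = (\<Sum>l<k. 1)" using k by (intro sum.cong refl) (auto simp: U)
    finally show "(\<Sum>i<n. P i i) = real k" by simp
  qed
  moreover have "S_k k A = (\<Sum>i<n. \<Sum>j<n. P i j * A $$ (i,j))"
  proof -
    have "(\<Sum>i<n. \<Sum>j<n. P i j * A $$ (i,j))
      = (\<Sum>i<n. \<Sum>j<n. \<Sum>l<k. \<Sum>m<n. ?\<mu> m * (U i l * U i m) * (U j l * U j m))"
    proof (intro sum.cong refl)
      fix i j assume "i \<in> {..<n}" "j \<in> {..<n}"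
      then have "A $$ (i,j) = (\<Sum>l<n. ?\<mu> l * U i l * U j l)" by (simp add: AU)
      then show "P i j * A $$ (i,j) = (\<Sum>l<k. \<Sum>m<n. ?\<mu> m * (U i l * U i m) * (U j l * U j m))"
        unfolding P_def by (simp only: sum_product) (intro sum.cong refl, simp only: mult_ac)
    qed
    also have "\<dots> = (\<Sum>i<n. \<Sum>l<k. \<Sum>j<n. \<Sum>m<n. ?\<mu> m * (U i l * U i m) * (U j l * U j m))"
      by (intro sum.cong refl sum.swap)
    also have "\<dots> = (\<Sum>l<k. \<Sum>i<n. \<Sum>j<n. \<Sum>m<n. ?\<mu> m * (U i l * U i m) * (U j l * U j m))"
      by (rule sum.swap)
    also have "\<dots> = (\<Sum>l<k. \<Sum>i<n. \<Sum>m<n. \<Sum>j<n. ?\<mu> m * (U i l * U i m) * (U j l * U j m))"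
      by (intro sum.cong refl sum.swap)
    \<comment> \<open>By orthonormality the sum over j leaves only m = l; the sum over i is then the
      norm of a unit vector.\<close>
    also have "\<dots> = (\<Sum>l<k. \<Sum>i<n. \<Sum>m<n. if m = l then ?\<mu> m * (U i l * U i m) else 0)"
      unfolding sum_distrib_left[symmetric] using k by (intro sum.cong refl) (auto simp: U)
    also have "\<dots> = (\<Sum>l<k. \<Sum>i<n. ?\<mu> l * (U i l * U i l))"
      using k by (intro sum.cong refl) auto
    also have "\<dots> = (\<Sum>l<k. ?\<mu> l)"
      unfolding sum_distrib_left[symmetric] using k by (intro sum.cong refl) (auto simp: U)
    also have "\<dots> = S_k k A"
    proof -
      have "length (eigenvalues_desc A) = n" by (rule char_poly_eigenvalues_desc(2)[OF A sym])
      then show ?thesis unfolding S_k_def using k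
        by (simp add: sum_list_sum_nth atLeast0LessThan min_def)
    qed
    finally show ?thesis ..
  qed
  ultimately show ?thesis using that by blast
qed

subsection \<open>The signless Laplacian\<close>

text \<open>Let q be the form of Q = D + A, x = D^{-1} u and s = u^T D^{-1} u. Then q(u,u) = \<mu>,
  q(x,u) = \<mu> s, and Q \<le> 2D gives q(x,x) \<le> 2 x^T D x = 2s. Positivity of q at x - s u
  turns this into \<mu> s^2 \<le> 2s.\<close>

lemma signless_eigenvalue_bound:
  fixes a :: "nat \<Rightarrow> nat \<Rightarrow> real"
  assumes sym: "\<And>i j. i < n \<Longrightarrow> j < n \<Longrightarrow> a i j = a j i"
    and nonneg: "\<And>i j. i < n \<Longrightarrow> j < n \<Longrightarrow> 0 \<le> a i j"
    and d: "\<And>i. i < n \<Longrightarrow> d i = (\<Sum>j<n. a i j)" and d1: "\<And>i. i < n \<Longrightarrow> 1 \<le> d i"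
    and eig: "\<And>i. i < n \<Longrightarrow> (\<Sum>j<n. (a i j + (if i = j then d i else 0)) * u j) = \<mu> * u i"
    and unit: "(\<Sum>i<n. (u i)\<^sup>2) = 1"
  shows "0 \<le> \<mu>" "\<mu> * (\<Sum>i<n. (u i)\<^sup>2 / d i) \<le> 2"
proof -
  define q where "q x y = (\<Sum>i<n. \<Sum>j<n. (a i j + (if i = j then d i else 0)) * x i * y j)"
    for x y :: "nat \<Rightarrow> real"
  have q_split: "q x y = (\<Sum>i<n. \<Sum>j<n. a i j * x i * y j) + (\<Sum>i<n. d i * x i * y i)" for x y
  proof -
    have "q x y = (\<Sum>i<n. \<Sum>j<n. a i j * x i * y j + (if i = j then d i * x i * y j else 0))"
      unfolding q_def by (intro sum.cong refl) (auto simp: algebra_simps)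
    then show ?thesis by (simp add: sum.distrib)
  qed
  have row: "(\<Sum>i<n. \<Sum>j<n. a i j * (x i)\<^sup>2) = (\<Sum>i<n. d i * x i * x i)" for x
    by (intro sum.cong refl) (auto simp: d sum_distrib_right[symmetric] power2_eq_square)
  have col: "(\<Sum>i<n. \<Sum>j<n. a i j * (x j)\<^sup>2) = (\<Sum>i<n. d i * x i * x i)" for x
    unfolding row[symmetric] by (subst sum.swap, intro sum.cong refl) (auto simp: sym)
  \<comment> \<open>A weighted sum of squares, so Q is positive semidefinite; \<open>q_minus\<close>
    shows in the same way that 2D - Q is.\<close>
  have q_plus: "2 * q x x = (\<Sum>i<n. \<Sum>j<n. a i j * (x i + x j)\<^sup>2)" for x
  proof -
    have "(\<Sum>i<n. \<Sum>j<n. a i j * (x i + x j)\<^sup>2) = (\<Sum>i<n. \<Sum>j<n. a i j * (x i)\<^sup>2)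
        + (\<Sum>i<n. \<Sum>j<n. a i j * (x j)\<^sup>2) + 2 * (\<Sum>i<n. \<Sum>j<n. a i j * x i * x j)"
      unfolding sum_distrib_left sum.distrib[symmetric]
      by (intro sum.cong refl) (simp add: power2_eq_square algebra_simps)
    then show ?thesis by (simp add: q_split row col)
  qed
  have q_minus: "4 * (\<Sum>i<n. d i * x i * x i) - 2 * q x x = (\<Sum>i<n. \<Sum>j<n. a i j * (x i - x j)\<^sup>2)" for x
  proof -
    have "(\<Sum>i<n. \<Sum>j<n. a i j * (x i - x j)\<^sup>2) = (\<Sum>i<n. \<Sum>j<n. a i j * (x i)\<^sup>2)
        + (\<Sum>i<n. \<Sum>j<n. a i j * (x j)\<^sup>2) - 2 * (\<Sum>i<n. \<Sum>j<n. a i j * x i * x j)"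
      unfolding sum_distrib_left sum.distrib[symmetric] sum_subtractf[symmetric]
      by (intro sum.cong refl) (simp add: power2_eq_square algebra_simps)
    then show ?thesis by (simp add: q_split row col)
  qed
  have q_nonneg: "0 \<le> q x x" for x
  proof -
    have "0 \<le> 2 * q x x" unfolding q_plus by (intro sum_nonneg mult_nonneg_nonneg nonneg) auto
    then show ?thesis by simp
  qed
  have q_le: "q x x \<le> 2 * (\<Sum>i<n. d i * x i * x i)" for x
  proof -
    have "0 \<le> 4 * (\<Sum>i<n. d i * x i * x i) - 2 * q x x"
      unfolding q_minus by (intro sum_nonneg mult_nonneg_nonneg nonneg) auto
    then show ?thesis by simp
  qed
  have q_u: "q x u = \<mu> * (\<Sum>i<n. x i * u i)" for x
  proof -
    have "q x u = (\<Sum>i<n. x i * (\<Sum>j<n. (a i j + (if i = j then d i else 0)) * u j))"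
      unfolding q_def sum_distrib_left by (intro sum.cong refl) (simp only: mult_ac)
    also have "\<dots> = (\<Sum>i<n. x i * (\<mu> * u i))" by (intro sum.cong refl) (simp only: eig lessThan_iff)
    finally show ?thesis by (simp add: sum_distrib_left mult_ac)
  qed
  have q_sym: "q x y = q y x" for x y
    unfolding q_def by (subst sum.swap, intro sum.cong refl) (auto simp: sym)
  show mu: "0 \<le> \<mu>" using q_nonneg[of u] unit by (simp add: q_u power2_eq_square)
  define s where "s = (\<Sum>i<n. (u i)\<^sup>2 / d i)"
  define x where "x i = u i / d i" for i
  have dpos: "0 < d i" if "i < n" for i using d1[OF that] by simp
  have s_x: "(\<Sum>i<n. x i * u i) = s" unfolding s_def x_def
    by (intro sum.cong) (auto simp: power2_eq_square)
  have s_xx: "(\<Sum>i<n. d i * x i * x i) = s" unfolding s_def x_def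
    using dpos by (intro sum.cong refl) (fastforce simp: power2_eq_square)
  have s0: "0 \<le> s" unfolding s_def using dpos by (intro sum_nonneg) (auto simp: less_imp_le)
  \<comment> \<open>Cauchy--Schwarz for the semi-inner product q, applied to x and u.\<close>
  have "q (\<lambda>i. x i - s * u i) (\<lambda>i. x i - s * u i) = q x x - 2 * s * q x u + s\<^sup>2 * q u u"
  proof -
    have "q (\<lambda>i. x i - s * u i) (\<lambda>i. x i - s * u i) = q x x - s * q x u - s * q u x + s\<^sup>2 * q u u"
      unfolding q_def sum_distrib_left sum.distrib[symmetric] sum_subtractf[symmetric]
      by (intro sum.cong refl) (simp add: power2_eq_square algebra_simps)
    then show ?thesis using q_sym[of u x] by simp
  qed
  also have "q u u = \<mu>" using unit by (simp add: q_u power2_eq_square)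
  also have "q x u = \<mu> * s" by (simp add: q_u s_x)
  finally have "0 \<le> q x x - 2 * s * (\<mu> * s) + s\<^sup>2 * \<mu>"
    using q_nonneg[of "\<lambda>i. x i - s * u i"] by simp
  also have "\<dots> \<le> 2 * s - s * (\<mu> * s)" using q_le[of x] unfolding s_xx by (simp add: power2_eq_square algebra_simps)
  finally have "s * (\<mu> * s) \<le> s * 2" by simp
  then have "\<mu> * s \<le> 2" using s0 by (cases "s = 0") auto
  then show "\<mu> * (\<Sum>i<n. (u i)\<^sup>2 / d i) \<le> 2" unfolding s_def .
qed

text \<open>In an eigenbasis of Q the trace is the sum of \<mu>_l c_l, where the weights c_l = u_l^T
  P u_l lie in [0,1] and add up to \<open>k\<close>. The excess of \<mu>_l over 2 is charged to
  \<mu>_l g_l with g_l = u_l^T (I - D^{-1}) u_l.\<close>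

lemma orth_proj_signless_le:
  fixes a :: "nat \<Rightarrow> nat \<Rightarrow> real"
  assumes P: "orth_proj n k P" and k: "k \<le> n"
    and sym: "\<And>i j. i < n \<Longrightarrow> j < n \<Longrightarrow> a i j = a j i"
    and nonneg: "\<And>i j. i < n \<Longrightarrow> j < n \<Longrightarrow> 0 \<le> a i j"
    and diag: "\<And>i. i < n \<Longrightarrow> a i i = 0"
    and d: "\<And>i. i < n \<Longrightarrow> d i = (\<Sum>j<n. a i j)" and d1: "\<And>i. i < n \<Longrightarrow> 1 \<le> d i"
  shows "(\<Sum>i<n. \<Sum>j<n. P i j * (a i j + (if i = j then d i else 0))) \<le> 2 * real k + (\<Sum>i<n. d i - 1)"
proof -
  define Q where "Q i j = a i j + (if i = j then d i else 0)" for i j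
  define M where "M = mat n n (\<lambda>(i,j). Q i j)"
  have M: "M \<in> carrier_mat n n" and symM: "transpose_mat M = M"
    by (auto simp: M_def Q_def sym intro!: eq_matI)
  define \<mu> where "\<mu> l = eigenvalues_desc M ! l" for l
  obtain U :: "nat \<Rightarrow> nat \<Rightarrow> real" where
    U: "\<And>i j. i < n \<Longrightarrow> j < n \<Longrightarrow> (\<Sum>l<n. U l i * U l j) = (if i = j then 1 else 0)"
    and U': "\<And>i j. i < n \<Longrightarrow> j < n \<Longrightarrow> (\<Sum>l<n. U i l * U j l) = (if i = j then 1 else 0)"
    and "\<And>i j. i < n \<Longrightarrow> j < n \<Longrightarrow> M $$ (i,j) = (\<Sum>l<n. \<mu> l * U i l * U j l)"
    unfolding \<mu>_def by (rule spectral_decomposition[OF M symM]) blast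
  then have QU: "Q i j = (\<Sum>l<n. \<mu> l * U i l * U j l)" if "i < n" "j < n" for i j
    using that by (simp add: M_def)
  have eig: "(\<Sum>j<n. Q i j * U j l) = \<mu> l * U i l" if i: "i < n" and l: "l < n" for i l
  proof -
    have "(\<Sum>j<n. Q i j * U j l) = (\<Sum>j<n. \<Sum>h<n. \<mu> h * U i h * (U j h * U j l))"
      using i by (intro sum.cong refl) (simp add: QU sum_distrib_left sum_distrib_right mult_ac)
    also have "\<dots> = (\<Sum>h<n. \<Sum>j<n. \<mu> h * U i h * (U j h * U j l))" by (rule sum.swap)
    also have "\<dots> = (\<Sum>h<n. if h = l then \<mu> h * U i h else 0)"
      unfolding sum_distrib_left[symmetric] using l by (intro sum.cong refl) (auto simp: U)
    finally show ?thesis using l by simp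
  qed
  have unit: "(\<Sum>i<n. (U i l)\<^sup>2) = 1" if "l < n" for l
    using U[OF that that] by (simp add: power2_eq_square)
  note bound = signless_eigenvalue_bound[of n a d, OF sym nonneg d d1, of "\<lambda>j. U j l" "\<mu> l" for l]
  have mu0: "0 \<le> \<mu> l" and mu2: "\<mu> l * (\<Sum>i<n. (U i l)\<^sup>2 / d i) \<le> 2" if l: "l < n" for l
    using bound[OF _ _ _ _ _ _ _ unit[OF l]] eig[OF _ l] unfolding Q_def by auto
  define c where "c l = (\<Sum>i<n. \<Sum>j<n. P i j * U i l * U j l)" for l
  have c: "0 \<le> c l" "c l \<le> 1" if "l < n" for l
    using orth_proj_quadratic_nonneg[OF P, of "\<lambda>i. U i l"]
      orth_proj_quadratic_le[OF P k, of "\<lambda>i. U i l"] unit[OF that] by (auto simp: c_def)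
  define g where "g l = (\<Sum>i<n. (U i l)\<^sup>2 * (1 - 1 / d i))" for l
  have g: "g l = 1 - (\<Sum>i<n. (U i l)\<^sup>2 / d i)" if "l < n" for l
    unfolding g_def by (simp add: algebra_simps sum_subtractf unit[OF that])
  have g0: "0 \<le> g l" for l
    unfolding g_def using d1 by (intro sum_nonneg mult_nonneg_nonneg) (fastforce simp: divide_le_eq)+
  \<comment> \<open>\<mu> - 2 \<le> \<mu> g is multiplied by c \<ge> 0; on the right c may be
    replaced by 1 since \<mu> g \<ge> 0.\<close>
  have le: "\<mu> l * c l \<le> 2 * c l + \<mu> l * g l" if l: "l < n" for l
  proof -
    have "\<mu> l - 2 \<le> \<mu> l * g l" using mu2[OF l] by (simp add: g[OF l] algebra_simps)
    then have "c l * (\<mu> l - 2) \<le> c l * (\<mu> l * g l)" using c[OF l] by (intro mult_left_mono)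
    also have "\<dots> \<le> 1 * (\<mu> l * g l)" using c[OF l] mu0[OF l] g0[of l] by (intro mult_right_mono) auto
    finally show ?thesis by (simp add: algebra_simps)
  qed
  have sum_c: "(\<Sum>l<n. c l) = real k"
  proof -
    have "(\<Sum>l<n. c l) = (\<Sum>i<n. \<Sum>l<n. \<Sum>j<n. P i j * U i l * U j l)" unfolding c_def by (rule sum.swap)
    also have "\<dots> = (\<Sum>i<n. \<Sum>j<n. \<Sum>l<n. P i j * U i l * U j l)" by (intro sum.cong refl sum.swap)
    also have "\<dots> = (\<Sum>i<n. \<Sum>j<n. if i = j then P i j else 0)"
      by (intro sum.cong refl) (auto simp: mult.assoc sum_distrib_left[symmetric] U')
    also have "\<dots> = real k" using orth_projD(4)[OF P] by simp
    finally show ?thesis .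
  qed
  \<comment> \<open>The sum is tr((I - D^{-1}) Q), and the diagonal of Q is \<open>d\<close> because
    that of \<open>a\<close> vanishes.\<close>
  have sum_g: "(\<Sum>l<n. \<mu> l * g l) = (\<Sum>i<n. d i - 1)"
  proof -
    have "(\<Sum>l<n. \<mu> l * g l) = (\<Sum>l<n. \<Sum>i<n. (1 - 1 / d i) * (\<mu> l * U i l * U i l))"
      unfolding g_def sum_distrib_left by (intro sum.cong refl) (simp only: power2_eq_square mult_ac)
    also have "\<dots> = (\<Sum>i<n. \<Sum>l<n. (1 - 1 / d i) * (\<mu> l * U i l * U i l))" by (rule sum.swap)
    also have "\<dots> = (\<Sum>i<n. (1 - 1 / d i) * d i)"
      unfolding sum_distrib_left[symmetric]
      by (intro sum.cong refl) (auto simp: QU[symmetric] Q_def diag)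
    also have "\<dots> = (\<Sum>i<n. d i - 1)"
    proof (intro sum.cong refl)
      fix i assume "i \<in> {..<n}"
      then have "d i \<noteq> 0" using d1[of i] by auto
      then show "(1 - 1 / d i) * d i = d i - 1" by (simp add: algebra_simps)
    qed
    finally show ?thesis .
  qed
  have "(\<Sum>i<n. \<Sum>j<n. P i j * Q i j) = (\<Sum>i<n. \<Sum>j<n. \<Sum>l<n. \<mu> l * (P i j * U i l * U j l))"
    by (intro sum.cong refl) (auto simp: QU sum_distrib_left mult_ac)
  also have "\<dots> = (\<Sum>i<n. \<Sum>l<n. \<Sum>j<n. \<mu> l * (P i j * U i l * U j l))" by (intro sum.cong refl sum.swap)
  also have "\<dots> = (\<Sum>l<n. \<Sum>i<n. \<Sum>j<n. \<mu> l * (P i j * U i l * U j l))" by (rule sum.swap)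
  also have "\<dots> = (\<Sum>l<n. \<mu> l * c l)" unfolding c_def sum_distrib_left[symmetric] ..
  also have "\<dots> \<le> (\<Sum>l<n. 2 * c l + \<mu> l * g l)" using le by (intro sum_mono) auto
  also have "\<dots> = 2 * real k + (\<Sum>i<n. d i - 1)"
    by (simp add: sum.distrib sum_distrib_left[symmetric] sum_c sum_g)
  finally show ?thesis unfolding Q_def .
qed

subsection \<open>Projections and adjacency matrices of forests\<close>

text \<open>Each edge outside \<open>T\<close> contributes two entries of P, both at most
  1/2.\<close>

lemma orth_proj_adj_le_subgraph:
  assumes P: "orth_proj n k P" and k: "k \<le> n"
    and E: "simple_graph n E" and T: "simple_graph n T" and TE: "T \<subseteq> E"
  shows "(\<Sum>i<n. \<Sum>j<n. P i j * adj_entry E i j)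
    \<le> (\<Sum>i<n. \<Sum>j<n. P i j * adj_entry T i j) + (real (card E) - real (card T))"
proof -
  have le: "P i j * (adj_entry E i j - adj_entry T i j) \<le> 1/2 * (adj_entry E i j - adj_entry T i j)"
    if ij: "i < n" "j < n" for i j
  proof (cases "i = j")
    case True
    then show ?thesis using simple_graphD(2)[OF E] simple_graphD(2)[OF T] by (simp add: adj_entry_diag)
  next
    case False
    have "0 \<le> adj_entry E i j - adj_entry T i j" using TE by (auto simp: adj_entry_def)
    with orth_proj_off_diag_le[OF P k ij False] show ?thesis by (rule mult_right_mono)
  qed
  have "(\<Sum>i<n. \<Sum>j<n. P i j * adj_entry E i j) - (\<Sum>i<n. \<Sum>j<n. P i j * adj_entry T i j)
    = (\<Sum>i<n. \<Sum>j<n. P i j * (adj_entry E i j - adj_entry T i j))"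
    by (simp add: sum_subtractf right_diff_distrib)
  also have "\<dots> \<le> (\<Sum>i<n. \<Sum>j<n. 1/2 * (adj_entry E i j - adj_entry T i j))"
    using le by (intro sum_mono) auto
  also have "\<dots> = 1/2 * ((\<Sum>i<n. \<Sum>j<n. adj_entry E i j) - (\<Sum>i<n. \<Sum>j<n. adj_entry T i j))"
    by (simp only: sum_distrib_left[symmetric] sum_subtractf)
  also have "\<dots> = real (card E) - real (card T)"
    by (simp add: sum_adj_entry[OF E] sum_adj_entry[OF T])
  finally show ?thesis by simp
qed

lemma orth_proj_adj_le_vertex_cover:
  assumes P: "orth_proj n k P" and k: "k \<le> n" and T: "simple_graph n T"
    and C: "finite C" "\<And>e. e \<in> T \<Longrightarrow> e \<inter> C \<noteq> {}"
  shows "(\<Sum>i<n. \<Sum>j<n. P i j * adj_entry T i j) \<le> sqrt (real (card C) * real (card T))"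
proof -
  \<comment> \<open>Each edge is charged to one of its endpoints in C, which splits the graph into stars centred in C.\<close>
  define b where "b i j = (if i \<in> C \<and> (j \<notin> C \<or> i < j) then adj_entry T i j else 0)" for i j
  \<comment> \<open>An edge with both ends in \<open>C\<close> is assigned to its smaller end, so
    exactly one of the two summands is 1.\<close>
  have split: "adj_entry T i j = b i j + b j i" for i j
  proof (cases "{i, j} \<in> T")
    case True
    then have "{i, j} \<inter> C \<noteq> {}" by (rule C(2))
    moreover have "i \<noteq> j" using True adj_entry_diag[OF simple_graphD(2)[OF T], of i] by (auto simp: adj_entry_def)
    ultimately show ?thesis by (auto simp: b_def adj_entry_commute[of T j i])
  next
    case False
    then show ?thesis by (simp add: b_def adj_entry_def insert_commute)
  qed
  have swap: "(\<Sum>i<n. \<Sum>j<n. P i j * b j i) = (\<Sum>i<n. \<Sum>j<n. P i j * b i j)"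
    by (subst sum.swap, intro sum.cong refl) (auto simp: orth_projD(1)[OF P])
  have Pb: "(\<Sum>i<n. \<Sum>j<n. P i j * adj_entry T i j) = (\<Sum>i<n. 2 * (\<Sum>j<n. P i j * b i j))"
    unfolding split distrib_left sum.distrib swap by (simp add: sum_distrib_left)
  have "(\<Sum>i<n. \<Sum>j<n. b j i) = (\<Sum>i<n. \<Sum>j<n. b i j)" by (rule sum.swap)
  then have card_b: "(\<Sum>i<n. \<Sum>j<n. b i j) = real (card T)"
    using sum_adj_entry[OF T] unfolding split sum.distrib by simp
  define r where "r i = (\<Sum>j<n. b i j)" for i
  have r0: "0 \<le> r i" for i unfolding r_def b_def by (intro sum_nonneg) (auto simp: adj_entry_nonneg)
  have row: "2 * (\<Sum>j<n. P i j * b i j) \<le> (if i \<in> C then sqrt (r i) else 0)" if i: "i < n" for i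
  proof (cases "i \<in> C")
    case True
    define L where "L = {j. j < n \<and> b i j \<noteq> 0}"
    have b1: "b i j = 1" if "j \<in> L" for j using that by (auto simp: L_def b_def adj_entry_def split: if_splits)
    have L: "L \<subseteq> {..<n}" and b0: "\<forall>j\<in>{..<n} - L. b i j = 0" by (auto simp: L_def)
    have "i \<notin> L" by (simp add: L_def b_def True adj_entry_diag[OF simple_graphD(2)[OF T]])
    moreover have "(\<Sum>j<n. P i j * b i j) = (\<Sum>j\<in>L. P i j)"
      by (rule sum.mono_neutral_cong_right) (simp_all add: L b0 b1)
    moreover have "r i = (\<Sum>j\<in>L. 1)"
      unfolding r_def by (rule sum.mono_neutral_cong_right) (simp_all add: L b0 b1)
    ultimately show ?thesis using orth_proj_star_le[OF P k i L] True by simp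
  qed (simp add: b_def)
  \<comment> \<open>\<open>C\<close> may contain numbers that are not vertices; they are discarded
    here.\<close>
  let ?C = "C \<inter> {..<n}"
  have "(\<Sum>i<n. 2 * (\<Sum>j<n. P i j * b i j)) \<le> (\<Sum>i<n. if i \<in> C then sqrt (r i) else 0)"
    using row by (intro sum_mono) auto
  also have "\<dots> = (\<Sum>i\<in>?C. 1 * sqrt (r i))"
    by (rule sum.mono_neutral_cong_right) auto
  also have "\<dots> \<le> sqrt (real (card C) * real (card T))"
  proof (rule real_le_rsqrt)
    \<comment> \<open>Cauchy--Schwarz against the constant 1; the star sizes \<open>r i\<close> add
      up to the number of edges.\<close>
    have "(\<Sum>i\<in>?C. 1 * sqrt (r i))\<^sup>2 \<le> (\<Sum>i\<in>?C. 1\<^sup>2) * (\<Sum>i\<in>?C. (sqrt (r i))\<^sup>2)"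
      by (rule Cauchy_Schwarz_sum)
    also have "\<dots> = real (card ?C) * (\<Sum>i\<in>?C. r i)" using r0 by simp
    also have "\<dots> \<le> real (card C) * (\<Sum>i<n. r i)"
      using C(1) r0 by (intro mult_mono sum_mono2) (auto intro: card_mono sum_nonneg)
    also have "(\<Sum>i<n. r i) = real (card T)" unfolding r_def by (rule card_b)
    finally show "(\<Sum>i\<in>?C. 1 * sqrt (r i))\<^sup>2 \<le> real (card C) * real (card T)" .
  qed
  finally show ?thesis unfolding Pb .
qed

lemma orth_proj_forest_adj_le:
  assumes P: "orth_proj n k P" and k: "k \<le> n" and T: "simple_graph n T" and ac: "acyclic_graph T"
  shows "(\<Sum>i<n. \<Sum>j<n. P i j * adj_entry T i j) \<le> sqrt (real k * real (card T))"
    and "(\<Sum>i<n. \<Sum>j<n. P i j * adj_entry T i j) \<le> sqrt (real (n - k) * real (card T))"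
    and "(\<Sum>i<n. \<Sum>j<n. P i j * adj_entry T i j) \<le> sqrt (real (matching_number T) * real (card T))"
proof -
  note T' = simple_graphD[OF T]
  obtain f :: "nat \<Rightarrow> bool" where f: "\<And>u v. {u, v} \<in> T \<Longrightarrow> f u \<noteq> f v"
    using forest_two_coloring[OF T'(1,2) ac] by blast
  have f': "adj_entry T i j = 0" if "f i = f j" for i j
    using f[of i j] that by (auto simp: adj_entry_def)
  have sq: "(\<Sum>i<n. \<Sum>j<n. (adj_entry T i j)\<^sup>2) \<le> 2 * real (card T)"
    unfolding sum_adj_entry[OF T, symmetric] by (intro sum_mono) (simp add: adj_entry_def)
  show "(\<Sum>i<n. \<Sum>j<n. P i j * adj_entry T i j) \<le> sqrt (real k * real (card T))"
    using orth_proj_bipartite_le[where f = f, OF P f' sq] by linarith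
  let ?P = "\<lambda>i j. (if i = j then 1 else 0) - P i j"
  \<comment> \<open>The identity contributes nothing because the adjacency matrix has zero diagonal,
    so passing to I - P only changes the sign.\<close>
  have "(\<Sum>i<n. \<Sum>j<n. ?P i j * adj_entry T i j) = (\<Sum>i<n. \<Sum>j<n. - (P i j * adj_entry T i j))"
    by (intro sum.cong refl) (auto simp: adj_entry_diag[OF T'(2)])
  then show "(\<Sum>i<n. \<Sum>j<n. P i j * adj_entry T i j) \<le> sqrt (real (n - k) * real (card T))"
    using orth_proj_bipartite_le[where f = f, OF orth_proj_complement[OF P k] f' sq]
    by (simp add: sum_negf)
  obtain M C where M: "is_matching T M" and C: "finite C" "card C \<le> card M" "\<And>e. e \<in> T \<Longrightarrow> e \<inter> C \<noteq> {}"
    using forest_vertex_cover[OF T'(1,2) ac] by metis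
  have "card C \<le> matching_number T"
    using matching_card_le_matching_number[OF T'(1) M] C(2) by simp
  then have "sqrt (real (card C) * real (card T)) \<le> sqrt (real (matching_number T) * real (card T))"
    by (intro real_sqrt_le_mono mult_right_mono) auto
  then show "(\<Sum>i<n. \<Sum>j<n. P i j * adj_entry T i j) \<le> sqrt (real (matching_number T) * real (card T))"
    using orth_proj_adj_le_vertex_cover[OF P k T C(1,3)] by linarith
qed

section \<open>Bounds for the matrix \<open>A_alpha\<close> in the two ranges of \<alpha>\<close>

lemma S_k_A_alpha_orth_proj:
  assumes "simple_graph n E" and k: "k \<le> n"
  obtains P where "orth_proj n k P"
    "S_k k (A_alpha \<alpha> n E) = \<alpha> * (\<Sum>i<n. P i i * real (Defs.degree E i))
      + (1 - \<alpha>) * (\<Sum>i<n. \<Sum>j<n. P i j * adj_entry E i j)"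
proof -
  let ?A = "A_alpha \<alpha> n E"
  have A: "?A \<in> carrier_mat n n" by (simp add: A_alpha_def deg_matrix_def adj_matrix_def)
  have entry: "?A $$ (i,j) = \<alpha> * (if i = j then real (Defs.degree E i) else 0) + (1 - \<alpha>) * adj_entry E i j"
    if "i < n" "j < n" for i j
    using that by (simp add: A_alpha_def deg_matrix_def adj_matrix_def adj_entry_def)
  have "transpose_mat ?A = ?A"
    using A by (intro eq_matI) (auto simp: entry adj_entry_commute)
  then obtain P where P: "orth_proj n k P" and S: "S_k k ?A = (\<Sum>i<n. \<Sum>j<n. P i j * ?A $$ (i,j))"
    by (rule S_k_orth_proj[OF A _ k])
  have "S_k k ?A = (\<Sum>i<n. \<Sum>j<n. \<alpha> * (if i = j then P i j * real (Defs.degree E i) else 0)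
      + (1 - \<alpha>) * (P i j * adj_entry E i j))"
    unfolding S by (intro sum.cong refl) (auto simp: entry algebra_simps)
  also have "\<dots> = \<alpha> * (\<Sum>i<n. \<Sum>j<n. if i = j then P i j * real (Defs.degree E i) else 0)
      + (1 - \<alpha>) * (\<Sum>i<n. \<Sum>j<n. P i j * adj_entry E i j)"
    by (simp only: sum.distrib sum_distrib_left)
  also have "(\<Sum>i<n. \<Sum>j<n. if i = j then P i j * real (Defs.degree E i) else 0)
      = (\<Sum>i<n. P i i * real (Defs.degree E i))" by simp
  finally show ?thesis using that P by blast
qed

lemma orth_proj_connected_graph_bounds:
  assumes P: "orth_proj n k P" and k: "k \<le> n" and n: "2 \<le> n"
    and G: "simple_graph n E" and conn: "connected_graph n E"
  shows "(\<Sum>i<n. P i i * real (Defs.degree E i)) \<le> real k + 2 * real (card E) - real n"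
    and "(\<Sum>i<n. P i i * real (Defs.degree E i)) + (\<Sum>i<n. \<Sum>j<n. P i j * adj_entry E i j)
      \<le> 2 * real k + 2 * real (card E) - real n"
proof -
  note E = simple_graphD[OF G]
  let ?d = "\<lambda>i. real (Defs.degree E i)"
  have d: "Suc 0 \<le> Defs.degree E i" if "i < n" for i
    using connected_graph_degree_ge[OF conn E(1,3) that n] by simp
  then have d1: "1 \<le> ?d i" if "i < n" for i
    using that by simp
  have "(\<Sum>i<n. ?d i) = 2 * real (card E)"
    unfolding degree_eq_sum_adj_entry[OF G] by (rule sum_adj_entry[OF G])
  then have sum_d: "(\<Sum>i<n. ?d i - 1) = 2 * real (card E) - real n" by (simp add: sum_subtractf)
  show "(\<Sum>i<n. P i i * ?d i) \<le> real k + 2 * real (card E) - real n"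
    using orth_proj_weighted_diag_le[OF P k, of ?d, OF d1] sum_d by simp
  have "(\<Sum>i<n. \<Sum>j<n. P i j * (adj_entry E i j + (if i = j then ?d i else 0)))
      \<le> 2 * real k + (\<Sum>i<n. ?d i - 1)"
    by (rule orth_proj_signless_le[OF P k])
      (auto simp: adj_entry_commute adj_entry_nonneg adj_entry_diag[OF E(2)] degree_eq_sum_adj_entry[OF G, symmetric] d)
  moreover have "(\<Sum>i<n. \<Sum>j<n. P i j * (adj_entry E i j + (if i = j then ?d i else 0)))
      = (\<Sum>i<n. P i i * ?d i) + (\<Sum>i<n. \<Sum>j<n. P i j * adj_entry E i j)"
  proof -
    have "(\<Sum>i<n. \<Sum>j<n. P i j * (adj_entry E i j + (if i = j then ?d i else 0)))
      = (\<Sum>i<n. \<Sum>j<n. (if i = j then P i j * ?d i else 0) + P i j * adj_entry E i j)"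
      by (intro sum.cong refl) (auto simp: algebra_simps)
    then show ?thesis by (simp add: sum.distrib)
  qed
  ultimately show "(\<Sum>i<n. P i i * ?d i) + (\<Sum>i<n. \<Sum>j<n. P i j * adj_entry E i j)
      \<le> 2 * real k + 2 * real (card E) - real n" using sum_d by simp
qed

text \<open>All three square roots are admissible on the whole range \<open>1 \<le> k\<close>,
  \<open>k \<le> n\<close>; the case distinction of the theorem merely picks one.\<close>

lemma S_k_A_alpha_le_small:
  assumes G: "simple_graph n E" and conn: "connected_graph n E" and ST: "spanning_tree n E T"
    and \<alpha>: "0 \<le> \<alpha>" "\<alpha> < 1/2" and k: "1 \<le> k" "k \<le> n"
    and x: "x = sqrt (real k * (real n - 1)) \<or> x = sqrt (real (matching_number T) * (real n - 1))
      \<or> x = sqrt ((real n - real k) * (real n - 1))"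
  shows "S_k k (A_alpha \<alpha> n E)
    \<le> \<alpha> * (real n + 2 * real k - 2) + (1 - 2 * \<alpha>) * x + real (card E) - real n + 1"
proof -
  have TE: "T \<subseteq> E" and tree: "is_tree n T" and T: "simple_graph n T" and ac: "acyclic_graph T"
    using ST by (auto simp: spanning_tree_def is_tree_def)
  note E' = simple_graphD[OF G]
  have "Suc (card T) = n" by (rule tree_card_edges[OF tree])
  then have t: "real (card T) = real n - 1" by linarith
  obtain P where P: "orth_proj n k P" and S: "S_k k (A_alpha \<alpha> n E) = \<alpha> * (\<Sum>i<n. P i i * real (Defs.degree E i))
    + (1 - \<alpha>) * (\<Sum>i<n. \<Sum>j<n. P i j * adj_entry E i j)"
    by (rule S_k_A_alpha_orth_proj[OF G k(2)])
  let ?D = "\<Sum>i<n. P i i * real (Defs.degree E i)"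
  let ?A = "\<Sum>i<n. \<Sum>j<n. P i j * adj_entry E i j"
  have "(\<Sum>i<n. \<Sum>j<n. P i j * adj_entry T i j) \<le> x"
    using x orth_proj_forest_adj_le[OF P k(2) T ac] k(2) unfolding t by (auto simp: of_nat_diff)
  then have A: "?A \<le> x + real (card E) - real n + 1"
    using orth_proj_adj_le_subgraph[OF P k(2) G T TE] t by linarith
  have Q: "?D + ?A \<le> 2 * real k + 2 * real (card E) - real n"
  proof (cases "2 \<le> n")
    case True
    then show ?thesis by (rule orth_proj_connected_graph_bounds(2)[OF P k(2) _ G conn])
  next
    \<comment> \<open>For \<open>n = 1\<close> the single vertex is isolated and the degree bound
      fails, but both traces vanish and the right-hand side is positive.\<close>
    case False
    then have n1: "n = 1" using k by simp
    then have "?A = 0" by (simp add: adj_entry_diag[OF E'(2)])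
    moreover have "?D = 0" using n1 by (simp add: degree_eq_sum_adj_entry[OF G] adj_entry_diag[OF E'(2)])
    moreover have "real n = 1" "1 \<le> real k" using n1 k by simp_all
    ultimately show ?thesis by linarith
  qed
  \<comment> \<open>Both coefficients are nonnegative since 0 \<le> \<alpha> < 1/2, so the bounds
    \<open>Q\<close> and \<open>A\<close> can be inserted separately.\<close>
  have "S_k k (A_alpha \<alpha> n E) = \<alpha> * (?D + ?A) + (1 - 2 * \<alpha>) * ?A"
    unfolding S by (simp add: algebra_simps)
  also have "\<dots> \<le> \<alpha> * (2 * real k + 2 * real (card E) - real n) + (1 - 2 * \<alpha>) * (x + real (card E) - real n + 1)"
    using Q A \<alpha> by (intro add_mono mult_left_mono) auto
  also have "\<dots> = \<alpha> * (real n + 2 * real k - 2) + (1 - 2 * \<alpha>) * x + real (card E) - real n + 1"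
    by (simp add: algebra_simps)
  finally show ?thesis .
qed

lemma S_k_A_alpha_le_large:
  assumes G: "simple_graph n E" and conn: "connected_graph n E"
    and \<alpha>: "1/2 \<le> \<alpha>" "\<alpha> < 1" and k: "2 \<le> k" "k \<le> n"
  shows "S_k k (A_alpha \<alpha> n E) \<le> \<alpha> * (2 * real k + 2 * real (card E) - real n)"
proof -
  obtain P where P: "orth_proj n k P" and S: "S_k k (A_alpha \<alpha> n E) = \<alpha> * (\<Sum>i<n. P i i * real (Defs.degree E i))
    + (1 - \<alpha>) * (\<Sum>i<n. \<Sum>j<n. P i j * adj_entry E i j)"
    by (rule S_k_A_alpha_orth_proj[OF G k(2)])
  let ?D = "\<Sum>i<n. P i i * real (Defs.degree E i)"
  let ?A = "\<Sum>i<n. \<Sum>j<n. P i j * adj_entry E i j"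
  have n: "2 \<le> n" using k by simp
  note bounds = orth_proj_connected_graph_bounds[OF P k(2) n G conn]
  have "S_k k (A_alpha \<alpha> n E) = (2 * \<alpha> - 1) * ?D + (1 - \<alpha>) * (?D + ?A)"
    unfolding S by (simp add: algebra_simps)
  also have "\<dots> \<le> (2 * \<alpha> - 1) * (real k + 2 * real (card E) - real n) + (1 - \<alpha>) * (2 * real k + 2 * real (card E) - real n)"
    using bounds \<alpha> by (intro add_mono mult_left_mono) auto
  also have "\<dots> = \<alpha> * (2 * real (card E) - real n) + real k" by (simp add: algebra_simps)
  \<comment> \<open>The bound obtained so far has the summand k; it is weakened to 2 \<alpha> k,
    using \<alpha> \<ge> 1/2.\<close>
  also have "\<dots> \<le> \<alpha> * (2 * real (card E) - real n) + 2 * \<alpha> * real k"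
    using mult_right_mono[of 1 "2 * \<alpha>" "real k"] \<alpha> by simp
  finally show ?thesis by (simp add: algebra_simps)
qed

theorem theorem4p3:
  fixes n :: nat and E T :: "nat set set" and \<alpha> :: real and k :: nat
  assumes G: "simple_graph n E" and conn: "connected_graph n E"
    and ST: "spanning_tree n E T"
  defines "m \<equiv> card E" and "\<beta> \<equiv> matching_number T"
  shows
    "(0 \<le> \<alpha> \<and> \<alpha> < 1/2 \<longrightarrow>
       (1 \<le> k \<and> k \<le> \<beta> \<longrightarrow>
          S_k k (A_alpha \<alpha> n E) \<le> \<alpha> * (real n + 2 * real k - 2)
             + (1 - 2 * \<alpha>) * sqrt (real k * (real n - 1)) + real m - real n + 1) \<and>
       (\<beta> < k \<and> k \<le> n - \<beta> \<longrightarrow>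
          S_k k (A_alpha \<alpha> n E) \<le> \<alpha> * (real n + 2 * real k - 2)
             + (1 - 2 * \<alpha>) * sqrt (real \<beta> * (real n - 1)) + real m - real n + 1) \<and>
       (n - \<beta> < k \<and> k \<le> n \<longrightarrow>
          S_k k (A_alpha \<alpha> n E) \<le> \<alpha> * (real n + 2 * real k - 2)
             + (1 - 2 * \<alpha>) * sqrt ((real n - real k) * (real n - 1)) + real m - real n + 1))
     \<and> (1/2 \<le> \<alpha> \<and> \<alpha> < 1 \<longrightarrow> 2 \<le> k \<and> k \<le> n \<longrightarrow>
          S_k k (A_alpha \<alpha> n E) \<le> \<alpha> * (2 * real k + 2 * real m - real n))"
proof -
  have tree: "is_tree n T" using ST by (simp add: spanning_tree_def)
  have "finite T" using tree by (auto simp: is_tree_def intro: simple_graphD(1))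
  \<comment> \<open>Supplies \<open>k \<le> n\<close> in the first range, where \<open>k\<close> is
    bounded only by \<beta>.\<close>
  then have "\<beta> < n" using matching_number_le_card[of T] tree_card_edges[OF tree] by (simp add: \<beta>_def)
  then show ?thesis
    using S_k_A_alpha_le_small[OF G conn ST, of \<alpha> k] S_k_A_alpha_le_large[OF G conn, of \<alpha> k]
    by (auto simp: m_def \<beta>_def)
qed

end
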